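(* There exists a $2\times2$ matrix weight $W$ on $\mathbb{T}$ such that $W^{-1}\in L^1(\mathbb{T})$ and $\log W\in \mathrm{VMO}$, but the stationary process with spectral density $W$ is not completely regular.
   Context: $\mathbb{T}$ is the unit circle and $m$ the normalized Lebesgue measure on it; $|I|=m(I)$ for an arc $I$. A matrix weight is a nonnegative Hermitian matrix-valued function in $L^1(\mathbb{T})$, positive definite almost everywhere; $\log W$ is the Hermitian matrix logarithm defined pointwise a.e. A function $f\in L^1(\mathbb{T})$ is in BMO if $\sup_I\frac1{|I|}\int_I|f-f_I|\,dm<\infty$, where $f_I=\frac1{|I|}\int_I f\,dm$ and $I$ ranges over subarcs of $\mathbb{T}$; it is in VMO if in addition $\frac1{|I|}\int_I|f-f_I|\,dm\to0$ as $|I|\to0$ (uniformly in $I$). A matrix function is in VMO if all its entries are. A $d$-variate stationary process is a sequence $x(n)=(x_1(n),\dots,x_d(n))$, $n\in\mathbb{Z}$, of $d$-tuples of (complex-valued) random variables with finite second moments whose correlation matrix $Q(n,k)=\{\mathbb{E}\,x_i(n)\overline{x_j(k)}\}_{i,j}$ depends only on $n-k$; it has spectral density $W$ if $Q(n,k)=\widehat{W}(n-k)$ for all $n,k$. Every nonnegative integrable matrix function is the spectral density of some stationary process. With $\mathcal{X}_n$ and $\mathcal{X}^n$ the closed linear spans in $L^2(\Omega,dP)$ of $\{x_j(k):1\le j\le d,\ k<n\}$ and $\{x_j(k):1\le j\le d,\ k\ge n\}$, the process is completely regular if $\sup\{|\mathbb{E}(\xi\bar\eta)|:\xi\in\mathcal{X}_0,\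 \eta\in\mathcal{X}^n,\ \mathbb{E}|\xi|^2\le1,\ \mathbb{E}|\eta|^2\le1\}\to0$ as $n\to\infty$. In terms of the spectral density this is equivalent to the following: in the space $L^2(W)$ of $\mathbb{C}^d$-valued functions with $\|f\|^2_{L^2(W)}=\int_{\mathbb{T}}(Wf,f)_{\mathbb{C}^d}\,dm$, one has $\sup\{|(\xi,\eta)_{L^2(W)}|:\xi\in X_0,\ \eta\in X^n,\ \|\xi\|\le1,\ \|\eta\|\le1\}\to0$, where $X_n=\overline{\operatorname{span}}\{z^k\mathbb{C}^d:k<n\}$ and $X^n=\overline{\operatorname{span}}\{z^k\mathbb{C}^d:k\ge n\}$. *)

theory Defs
  imports "HOL-Probability.Probability"
begin

text \<open>Functions on the circle are functions on \<open>complex\<close>; the measure lives on the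
  Borel sets of the circle, so their values elsewhere are irrelevant.\<close>

definition circle_measure :: "complex measure" where
  "circle_measure =
     distr (uniform_measure lborel {0..<2 * pi}) (restrict_space borel (sphere 0 1)) cis"

definition is_arc :: "complex set \<Rightarrow> bool" where
  "is_arc I \<longleftrightarrow> (\<exists>a b. a < b \<and> b \<le> a + 2 * pi \<and> I = cis ` {a..b})"

definition arc_mean :: "(complex \<Rightarrow> complex) \<Rightarrow> complex set \<Rightarrow> complex" where
  "arc_mean f I = (LINT z:I|circle_measure. f z) /\<^sub>R measure circle_measure I"

definition mean_osc :: "(complex \<Rightarrow> complex) \<Rightarrow> complex set \<Rightarrow> real" where
  "mean_osc f I =
     (LINT z:I|circle_measure. cmod (f z - arc_mean f I)) / measure circle_measure I"

definition BMO :: "(complex \<Rightarrow> complex) set" where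
  "BMO = {f. integrable circle_measure f \<and> bdd_above (mean_osc f ` {I. is_arc I})}"

definition VMO :: "(complex \<Rightarrow> complex) set" where
  "VMO = {f \<in> BMO. \<forall>\<epsilon>>0. \<exists>\<delta>>0. \<forall>I. is_arc I \<and> measure circle_measure I < \<delta> \<longrightarrow> mean_osc f I < \<epsilon>}"

definition matrix_VMO :: "(complex \<Rightarrow> complex^'d^'d) set" where
  "matrix_VMO = {F. \<forall>i j. (\<lambda>z. F z $ i $ j) \<in> VMO}"

definition adjoint_matrix :: "complex^'n^'m \<Rightarrow> complex^'m^'n" where
  "adjoint_matrix A = (\<chi> i j. cnj (A $ j $ i))"

definition hermitian :: "complex^'d^'d \<Rightarrow> bool" where
  "hermitian A \<longleftrightarrow> adjoint_matrix A = A"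

definition cinner_vec :: "complex^'d \<Rightarrow> complex^'d \<Rightarrow> complex" where
  "cinner_vec u v = (\<Sum>i\<in>UNIV. u $ i * cnj (v $ i))"

text \<open>For Hermitian \<open>A\<close> the form \<open>cinner_vec (A *v v) v\<close> is real, so its real part
  carries all the information.\<close>

definition nonneg_matrix :: "complex^'d^'d \<Rightarrow> bool" where
  "nonneg_matrix A \<longleftrightarrow> hermitian A \<and> (\<forall>v. 0 \<le> Re (cinner_vec (A *v v) v))"

definition posdef_matrix :: "complex^'d^'d \<Rightarrow> bool" where
  "posdef_matrix A \<longleftrightarrow> hermitian A \<and> (\<forall>v. v \<noteq> 0 \<longrightarrow> 0 < Re (cinner_vec (A *v v) v))"

definition matrix_weight :: "(complex \<Rightarrow> complex^'d^'d) \<Rightarrow> bool" where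
  "matrix_weight W \<longleftrightarrow>
     integrable circle_measure W \<and>
     (\<forall>z\<in>sphere 0 1. nonneg_matrix (W z)) \<and>
     (AE z in circle_measure. posdef_matrix (W z))"

definition unitary_matrix :: "complex^'d^'d \<Rightarrow> bool" where
  "unitary_matrix U \<longleftrightarrow> adjoint_matrix U ** U = mat 1 \<and> U ** adjoint_matrix U = mat 1"

definition real_diag :: "('d \<Rightarrow> real) \<Rightarrow> complex^'d^'d" where
  "real_diag d = (\<chi> i j. if i = j then complex_of_real (d i) else 0)"

text \<open>Functional calculus on Hermitian matrices, as a relation: \<open>B = f(A)\<close>.\<close>

definition hermitian_calc ::
  "(real \<Rightarrow> real) \<Rightarrow> complex^'d^'d \<Rightarrow> complex^'d^'d \<Rightarrow> bool" where
  "hermitian_calc f A B \<longleftrightarrow>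
     (\<exists>U d. unitary_matrix U \<and> A = U ** real_diag d ** adjoint_matrix U \<and>
            B = U ** real_diag (f \<circ> d) ** adjoint_matrix U)"

lemma hermitian_calc_unique:
  assumes "hermitian_calc f A B" and "hermitian_calc f A C"
  shows "B = C"
proof -
  obtain U d where U: "unitary_matrix U" "A = U ** real_diag d ** adjoint_matrix U"
      "B = U ** real_diag (f \<circ> d) ** adjoint_matrix U"
    using assms(1) unfolding hermitian_calc_def by blast
  obtain V e where V: "unitary_matrix V" "A = V ** real_diag e ** adjoint_matrix V"
      "C = V ** real_diag (f \<circ> e) ** adjoint_matrix V"
    using assms(2) unfolding hermitian_calc_def by blast
  define P where "P = adjoint_matrix V ** U"
  have cancel: "adjoint_matrix V ** (V ** X) = X" "V ** (adjoint_matrix V ** X) = X"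
    "adjoint_matrix U ** (U ** X) = X" "U ** (adjoint_matrix U ** X) = X"
    "X ** adjoint_matrix U ** U = X"
    for X
    using U(1) V(1) unfolding unitary_matrix_def
    by (metis matrix_mul_assoc matrix_mul_lid matrix_mul_rid)+
  have "U ** real_diag d ** adjoint_matrix U = V ** real_diag e ** adjoint_matrix V"
    using U(2) V(2) by simp
  then have "adjoint_matrix V ** (U ** real_diag d ** adjoint_matrix U) ** U
           = adjoint_matrix V ** (V ** real_diag e ** adjoint_matrix V) ** U"
    by simp
  then have PD: "P ** real_diag d = real_diag e ** P"
    by (metis P_def cancel(1,5) matrix_mul_assoc)
  have r: "(X ** real_diag g) $ i $ j = X $ i $ j * complex_of_real (g j)" for X :: "complex^'d^'d" and g i j
    by (simp add: matrix_matrix_mult_def real_diag_def if_distrib[of "\<lambda>y. _ * y"] cong: if_cong)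
  have l: "(real_diag g ** X) $ i $ j = complex_of_real (g i) * X $ i $ j" for X :: "complex^'d^'d" and g i j
    by (simp add: matrix_matrix_mult_def real_diag_def if_distrib[of "\<lambda>y. y * _"] cong: if_cong)
  have "P $ i $ j * complex_of_real (f (d j)) = complex_of_real (f (e i)) * P $ i $ j" for i j
  proof -
    have "P $ i $ j * complex_of_real (d j) = complex_of_real (e i) * P $ i $ j"
      using arg_cong[OF PD, of "\<lambda>X. X $ i $ j"] by (simp add: r l)
    then have "P $ i $ j = 0 \<or> d j = e i" by auto
    then show ?thesis by auto
  qed
  then have "P ** real_diag (f \<circ> d) = real_diag (f \<circ> e) ** P"
    by (simp add: vec_eq_iff r l)
  then have "V ** (P ** real_diag (f \<circ> d)) ** adjoint_matrix U
           = V ** (real_diag (f \<circ> e) ** P) ** adjoint_matrix U"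
    by simp
  moreover have "V ** (P ** real_diag (f \<circ> d)) ** adjoint_matrix U = B"
    by (metis P_def U(3) cancel(2) matrix_mul_assoc)
  moreover have "V ** (real_diag (f \<circ> e) ** P) ** adjoint_matrix U = C"
    by (metis P_def V(3) U(1) matrix_mul_assoc matrix_mul_rid unitary_matrix_def)
  ultimately show ?thesis by simp
qed

text \<open>Only the values at positive definite \<open>A\<close> matter; there \<open>B\<close> exists by the spectral
  theorem and is unique by the lemma above.\<close>

definition matrix_log :: "complex^'d^'d \<Rightarrow> complex^'d^'d" where
  "matrix_log A = (THE B. hermitian_calc ln A B)"

lemma matrix_log_eqI: "hermitian_calc ln A B \<Longrightarrow> matrix_log A = B"
  unfolding matrix_log_def by (rule the_equality) (auto dest: hermitian_calc_unique)

text \<open>The variables are not assumed centered: \<open>correlation\<close> is the matrix of plain second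
  moments.\<close>

definition correlation ::
  "'a measure \<Rightarrow> (int \<Rightarrow> 'a \<Rightarrow> complex^'d) \<Rightarrow> int \<Rightarrow> int \<Rightarrow> complex^'d^'d" where
  "correlation M x n k = (\<chi> i j. LINT \<omega>|M. x n \<omega> $ i * cnj (x k \<omega> $ j))"

definition stationary_process :: "'a measure \<Rightarrow> (int \<Rightarrow> 'a \<Rightarrow> complex^'d) \<Rightarrow> bool" where
  "stationary_process M x \<longleftrightarrow>
     prob_space M \<and>
     (\<forall>n. x n \<in> borel_measurable M) \<and>
     (\<forall>n j. integrable M (\<lambda>\<omega>. (cmod (x n \<omega> $ j))\<^sup>2)) \<and>
     (\<forall>n k n' k'. n - k = n' - k' \<longrightarrow> correlation M x n k = correlation M x n' k')"

definition fourier_coeff :: "(complex \<Rightarrow> complex^'d^'d) \<Rightarrow> int \<Rightarrow> complex^'d^'d" where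
  "fourier_coeff W n = (\<chi> i j. LINT z|circle_measure. W z $ i $ j * z powi (- n))"

definition has_spectral_density ::
  "'a measure \<Rightarrow> (int \<Rightarrow> 'a \<Rightarrow> complex^'d) \<Rightarrow> (complex \<Rightarrow> complex^'d^'d) \<Rightarrow> bool" where
  "has_spectral_density M x W \<longleftrightarrow> (\<forall>n k. correlation M x n k = fourier_coeff W (n - k))"

text \<open>\<open>L\<^sup>2\<close> is represented by functions rather than classes; closed spans are therefore
  saturated under a.e. equality.\<close>

definition L2 :: "'a measure \<Rightarrow> ('a \<Rightarrow> complex) set" where
  "L2 M = {\<xi> \<in> borel_measurable M. integrable M (\<lambda>\<omega>. (cmod (\<xi> \<omega>))\<^sup>2)}"

definition fun_span :: "('a \<Rightarrow> complex) set \<Rightarrow> ('a \<Rightarrow> complex) set" where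
  "fun_span S = {(\<lambda>\<omega>. \<Sum>g\<in>F. c g * g \<omega>) | F c. finite F \<and> F \<subseteq> S}"

definition L2_closed_span :: "'a measure \<Rightarrow> ('a \<Rightarrow> complex) set \<Rightarrow> ('a \<Rightarrow> complex) set" where
  "L2_closed_span M S =
     {\<xi> \<in> L2 M. \<forall>\<epsilon>>0. \<exists>g\<in>fun_span S. (LINT \<omega>|M. (cmod (\<xi> \<omega> - g \<omega>))\<^sup>2) < \<epsilon>}"

definition past :: "'a measure \<Rightarrow> (int \<Rightarrow> 'a \<Rightarrow> complex^'d) \<Rightarrow> int \<Rightarrow> ('a \<Rightarrow> complex) set" where
  "past M x n = L2_closed_span M {(\<lambda>\<omega>. x k \<omega> $ j) | j k. k < n}"

definition future :: "'a measure \<Rightarrow> (int \<Rightarrow> 'a \<Rightarrow> complex^'d) \<Rightarrow> int \<Rightarrow> ('a \<Rightarrow> complex) set" where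
  "future M x n = L2_closed_span M {(\<lambda>\<omega>. x k \<omega> $ j) | j k. n \<le> k}"

text \<open>The set below contains 0 and is bounded by 1 (Cauchy--Schwarz), so the real supremum
  is the genuine one.\<close>

definition regularity_coeff :: "'a measure \<Rightarrow> (int \<Rightarrow> 'a \<Rightarrow> complex^'d) \<Rightarrow> nat \<Rightarrow> real" where
  "regularity_coeff M x n =
     Sup {cmod (LINT \<omega>|M. \<xi> \<omega> * cnj (\<eta> \<omega>)) | \<xi> \<eta>.
            \<xi> \<in> past M x 0 \<and> \<eta> \<in> future M x (int n) \<and>
            (LINT \<omega>|M. (cmod (\<xi> \<omega>))\<^sup>2) \<le> 1 \<and> (LINT \<omega>|M. (cmod (\<eta> \<omega>))\<^sup>2) \<le> 1}"

definition completely_regular :: "'a measure \<Rightarrow> (int \<Rightarrow> 'a \<Rightarrow> complex^'d) \<Rightarrow> bool" where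
  "completely_regular M x \<longleftrightarrow> regularity_coeff M x \<longlonglongrightarrow> 0"

end

(* Near z = 1 let x = 2 - log_2 |1 - z| and let W have eigenvalues x and 1/x with an orthonormal
   eigenbasis turned by the angle arcsin g(x). Since log x has vanishing mean oscillation and
   (log x) g(x) is continuous and vanishes at z = 1, log W differs from log x diag(1,-1) by a
   continuous matrix, so log W is in VMO.
   The (2,2) entry of W is w = x g^2 + (1 - g^2)/x. Take g(x) = x^(-1/4) near the sparse points
   x = 4^k and g = 0 elsewhere: w is then of size sqrt x on an annulus around |1 - z| = 2^(-4^k) and at
   most 1 on the much longer zone outside it. Multiplying w by |P|^2, where P = sum_{j<N} z^j and N is a
   small multiple of 2^(4^k), puts almost all of the mass where z^m is close to 1 for all m <= 3N.
   Hence the sums of N consecutive second coordinates of the process, taken on both sides of a gap of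
   length n << N, are strongly correlated, for every n. *)
theory Submission
  imports Defs "HOL-Real_Asymp.Real_Asymp"
begin

text \<open>For a scalar weight, a logarithm in VMO forces complete regularity, so the failure must
  come from non-commutativity. A tilt g of the eigenbasis enters \<open>log W\<close> with the
  factor log x but enters W with the factor x: one needs (log x) g -> 0 and x g^2 -> infinity, and g
  = x^(-a) does this for every 0 < a < 1/2. Size alone is not enough: w must drop from its peak
  within boundedly many dyadic annuli, or its mass would not be concentrated at one scale. Hence the
  bumps have bounded width in x, which costs nothing because g tends to 0. The centres grow by the
  factor 4 so that the far region, where w is only known to be integrable, is harmless: beyond the
  previous peak d the kernel |P|^2 is of order 4^d, while N is of order 2^(4 d). Mass of w closer to
  1 than the annulus only helps, as z^m is close to 1 there too. The factor sqrt x by which the peak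
  beats its surroundings is unbounded, so all numerical constants can be chosen generously.\<close>

section \<open>Normalized Lebesgue measure on the circle\<close>

lemma cis_measurable [measurable]: "cis \<in> borel_measurable borel"
  by (intro borel_measurable_continuous_onI continuous_on_cis continuous_on_id)

lemma cis_measurable_sphere [measurable]: "cis \<in> lborel \<rightarrow>\<^sub>M restrict_space borel (sphere 0 1)"
  by (intro measurable_restrict_space2) (auto simp: measurable_lborel1)

lemma sets_circle_measure [measurable_cong]:
  "sets circle_measure = sets (restrict_space borel (sphere 0 1))"
  by (simp add: circle_measure_def)

lemma space_circle_measure [simp]: "space circle_measure = sphere 0 1"
  by (simp add: circle_measure_def space_restrict_space)

lemma measurable_circle_measure: "f \<in> borel_measurable borel \<Longrightarrow> f \<in> borel_measurable circle_measure"
  using measurable_restrict_space1 by (simp add: measurable_cong_sets[OF sets_circle_measure refl])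

lemma prob_space_circle_measure: "prob_space circle_measure"
  unfolding circle_measure_def
  by (intro prob_space.prob_space_distr prob_space_uniform_measure)
     (auto simp: measurable_cong_sets[OF sets_uniform_measure refl])

interpretation circle: prob_space circle_measure
  by (rule prob_space_circle_measure)

lemma cis_measurable_uniform [measurable]:
  "cis \<in> uniform_measure lborel A \<rightarrow>\<^sub>M restrict_space borel (sphere 0 1)"
  by (simp add: measurable_cong_sets[OF sets_uniform_measure refl])

lemma uniform_measure_interval:
  "0 < c \<Longrightarrow> uniform_measure lborel {0..<c::real} = density lborel (\<lambda>t. ennreal (indicator {0..<c} t / c))"
  unfolding uniform_measure_def
  by (intro arg_cong2[where f=density] ext refl)
     (auto simp: divide_ennreal[symmetric] indicator_def split: if_splits)

lemma integral_circle_measure: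
  fixes f :: "complex \<Rightarrow> 'b::{banach, second_countable_topology}"
  assumes [measurable]: "f \<in> borel_measurable circle_measure"
  shows "integral\<^sup>L circle_measure f = (LINT t:{0..<2*pi}|lborel. f (cis t)) /\<^sub>R (2*pi)"
    and "integrable circle_measure f \<longleftrightarrow> set_integrable lborel {0..<2*pi} (\<lambda>t. f (cis t))"
proof -
  have fm [measurable]: "f \<in> borel_measurable (restrict_space borel (sphere 0 1))"
    using assms by simp
  have [measurable]: "(\<lambda>t. f (cis t)) \<in> borel_measurable lborel"
    by measurable
  have "integral\<^sup>L circle_measure f = integral\<^sup>L (uniform_measure lborel {0..<2*pi}) (\<lambda>t. f (cis t))"
    unfolding circle_measure_def by (rule integral_distr) measurable
  also have "\<dots> = (LINT t|lborel. (indicator {0..<2*pi} t / (2*pi)) *\<^sub>R f (cis t))"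
    by (simp add: uniform_measure_interval integral_density)
  also have "\<dots> = (LINT t|lborel. (1/(2*pi)) *\<^sub>R (indicator {0..<2*pi} t *\<^sub>R f (cis t)))"
    by simp
  also have "\<dots> = (LINT t:{0..<2*pi}|lborel. f (cis t)) /\<^sub>R (2*pi)"
    unfolding set_lebesgue_integral_def by (simp only: integral_scaleR_right inverse_eq_divide)
  finally show "integral\<^sup>L circle_measure f = (LINT t:{0..<2*pi}|lborel. f (cis t)) /\<^sub>R (2*pi)" .
  have "integrable circle_measure f \<longleftrightarrow> integrable (uniform_measure lborel {0..<2*pi}) (\<lambda>t. f (cis t))"
    unfolding circle_measure_def by (rule integrable_distr_eq[where g=cis]) (use fm in auto)
  also have "\<dots> \<longleftrightarrow> integrable lborel (\<lambda>t. (indicator {0..<2*pi} t / (2*pi)) *\<^sub>R f (cis t))"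
    by (subst uniform_measure_interval, simp, rule integrable_density) auto
  also have "\<dots> \<longleftrightarrow> integrable lborel (\<lambda>t. (1/(2*pi)) *\<^sub>R (indicator {0..<2*pi} t *\<^sub>R f (cis t)))"
    by (intro arg_cong[where f="integrable lborel"] ext) simp
  also have "\<dots> \<longleftrightarrow> set_integrable lborel {0..<2*pi} (\<lambda>t. f (cis t))"
    unfolding set_integrable_def
    using integrable_scaleR_right[of "1/(2*pi)" lborel "\<lambda>t. indicator {0..<2*pi} t *\<^sub>R f (cis t)"]
      integrable_scaleR_right[of "2*pi" lborel "\<lambda>t. (1/(2*pi)) *\<^sub>R (indicator {0..<2*pi} t *\<^sub>R f (cis t))"]
    by (auto simp del: integrable_scaleR_right)
  finally show "integrable circle_measure f \<longleftrightarrow> set_integrable lborel {0..<2*pi} (\<lambda>t. f (cis t))" .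
qed

lemma measure_circle_measure:
  assumes "A \<in> sets circle_measure"
  shows "measure circle_measure A = measure lborel ({0..<2*pi} \<inter> cis -` A) / (2*pi)"
proof -
  have [measurable]: "A \<in> sets (restrict_space borel (sphere 0 1))"
    using assms sets_circle_measure by blast
  have *: "cis -` A \<in> sets lborel"
    using measurable_sets[OF cis_measurable_sphere, of A] by simp
  have "measure circle_measure A
      = measure (uniform_measure lborel {0..<2*pi}) (cis -` A \<inter> space (uniform_measure lborel {0..<2*pi}))"
    unfolding circle_measure_def by (rule measure_distr) measurable
  also have "\<dots> = measure lborel ({0..<2*pi} \<inter> cis -` A) / (2*pi)"
    using * by (subst measure_uniform_measure) auto
  finally show ?thesis .
qed

lemma sets_circle_measure_Collect:
  assumes "Measurable.pred borel P"
  shows "{z\<in>sphere 0 1. P z} \<in> sets circle_measure"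
proof -
  have "{z\<in>sphere 0 1. P z} = sphere 0 1 \<inter> {z\<in>space borel. P z}" by auto
  then show ?thesis
    using assms by (auto simp: sets_circle_measure sets_restrict_space pred_def)
qed

lemma norm_1_minus_cis: "cmod (1 - cis t) = 2 * \<bar>sin (t/2)\<bar>"
proof -
  have "(cmod (1 - cis t))\<^sup>2 = (1 - cos t)\<^sup>2 + (sin t)\<^sup>2"
    by (simp add: cmod_power2)
  also have "\<dots> = 2 - 2 * cos (2*(t/2))"
    using sin_cos_squared_add[of t] by (simp add: power2_eq_square algebra_simps)
  also have "\<dots> = (2 * \<bar>sin (t/2)\<bar>)\<^sup>2"
    by (subst cos_double_sin) (simp add: power2_eq_square)
  finally show ?thesis
    by (rule power2_eq_imp_eq) auto
qed

lemma norm_cis_diff_le: "cmod (cis s - cis t) \<le> \<bar>s - t\<bar>"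
proof -
  have "cis s - cis t = cis s * (1 - cis (t - s))"
    by (simp add: right_diff_distrib cis_mult)
  then have "cmod (cis s - cis t) = cmod (1 - cis (t - s))"
    by (simp add: norm_mult)
  also have "\<dots> \<le> \<bar>s - t\<bar>"
    using abs_sin_le_one abs_sin_x_le_abs_x[of "(t-s)/2"] by (simp add: norm_1_minus_cis)
  finally show ?thesis .
qed

text \<open>Jordan's inequality: sin is concave on [0, pi/2] and so lies above the chord through the
  endpoints. It turns bounds on the distance to 1 into bounds on the angle.\<close>

lemma sin_half_ge:
  assumes "0 \<le> t" "t \<le> pi"
  shows "t / pi \<le> sin (t/2)"
proof -
  have "concave_on {0..pi/2} sin"
  proof (rule f''_le0_imp_concave)
    fix x :: real assume "x \<in> {0..pi/2}"
    then show "- sin x \<le> 0" by (simp add: sin_ge_zero)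
  qed (auto intro!: derivative_eq_intros)
  from concave_onD[OF this, of "t/pi" 0 "pi/2"] assms show ?thesis
    by (simp add: divide_simps)
qed

lemma measure_circle_near_one:
  assumes "0 \<le> r"
  shows "measure circle_measure {z\<in>sphere 0 1. cmod (1 - z) \<le> r} \<le> r"
proof -
  have S: "{z\<in>sphere 0 1. cmod (1 - z) \<le> r} \<in> sets circle_measure"
    by (rule sets_circle_measure_Collect) measurable
  \<comment> \<open>The parameter interval is cut at the point 1, so its neighbourhood appears as
    two pieces, one at each end.\<close>
  have "{0..<2*pi} \<inter> cis -` {z\<in>sphere 0 1. cmod (1 - z) \<le> r} \<subseteq> {0..r*pi/2} \<union> {2*pi-r*pi/2..2*pi}"
  proof
    fix t assume "t \<in> {0..<2*pi} \<inter> cis -` {z\<in>sphere 0 1. cmod (1 - z) \<le> r}"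
    then have t: "0 \<le> t" "t < 2*pi" "2 * \<bar>sin (t/2)\<bar> \<le> r"
      by (auto simp: norm_1_minus_cis)
    show "t \<in> {0..r*pi/2} \<union> {2*pi-r*pi/2..2*pi}"
    proof (cases "t \<le> pi")
      case True
      with sin_half_ge[of t] t have "2 * (t/pi) \<le> r" by linarith
      then show ?thesis using t by (simp add: field_simps)
    next
      case False
      have "sin ((2*pi-t)/2) = sin (t/2)" by (simp add: diff_divide_distrib)
      with sin_half_ge[of "2*pi-t"] t False have "2 * ((2*pi-t)/pi) \<le> r" by linarith
      then have "2 * (2*pi-t) \<le> r * pi" by (simp add: field_simps)
      then show ?thesis using t by (simp add: field_simps)
    qed
  qed
  then have "measure lborel ({0..<2*pi} \<inter> cis -` {z\<in>sphere 0 1. cmod (1 - z) \<le> r})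
      \<le> measure lborel ({0..r*pi/2} \<union> {2*pi-r*pi/2..2*pi})"
    using S measurable_sets[OF cis_measurable_sphere, of "{z\<in>sphere 0 1. cmod (1 - z) \<le> r}"]
    by (intro measure_mono_fmeasurable) (auto simp: sets_circle_measure intro!: fmeasurableI emeasure_bounded_finite)
  also have "\<dots> \<le> measure lborel {0..r*pi/2} + measure lborel {2*pi-r*pi/2..2*pi}"
    by (intro measure_Un_le) auto
  also have "\<dots> = r * pi" using assms by simp
  finally have "measure lborel ({0..<2*pi} \<inter> cis -` {z\<in>sphere 0 1. cmod (1 - z) \<le> r}) \<le> r * pi" .
  then have "measure circle_measure {z\<in>sphere 0 1. cmod (1 - z) \<le> r} \<le> (r * pi) / (2*pi)"
    unfolding measure_circle_measure[OF S] by (rule divide_right_mono) simp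
  then show ?thesis using assms by simp
qed

text \<open>Angles between 2 r and 3 r suffice: their chords lie between 4 r / pi and 3 r, and 2 pi
  < 8. The ratio 16 of the radii is four dyadic scales, the width on which \<open>bump\<close> is at
  least 1/2.\<close>

lemma measure_circle_annulus:
  assumes "0 < r" "r \<le> 1"
  shows "r / 8 \<le> measure circle_measure {z\<in>sphere 0 1. r \<le> cmod (1 - z) \<and> cmod (1 - z) \<le> 16 * r}"
    (is "_ \<le> measure _ ?S")
proof -
  have S: "?S \<in> sets circle_measure"
    by (rule sets_circle_measure_Collect) measurable
  have sub: "{r*2..r*4} \<inter> {..<2*pi} \<inter> {..pi} \<subseteq> {0..<2*pi} \<inter> cis -` ?S"
  proof
    fix t assume t: "t \<in> {r*2..r*4} \<inter> {..<2*pi} \<inter> {..pi}"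
    then have t0: "0 \<le> t" "t \<le> pi" using assms by auto
    have "2 * (t/pi) \<le> 2 * \<bar>sin (t/2)\<bar>" using sin_half_ge[OF t0] by linarith
    moreover have "r \<le> 2 * (t/pi)"
    proof -
      have "r * pi \<le> r * 4" using assms pi_less_4 by (intro mult_left_mono) auto
      then show ?thesis using t by (simp add: field_simps)
    qed
    moreover have "2 * \<bar>sin (t/2)\<bar> \<le> 16 * r"
      using abs_sin_x_le_abs_x[of "t/2"] t assms t0 by auto
    ultimately show "t \<in> {0..<2*pi} \<inter> cis -` ?S"
      using t t0 by (auto simp: norm_1_minus_cis)
  qed
  have "{r*2..r*3} \<subseteq> {0..<2*pi} \<inter> cis -` ?S"
  proof -
    have "{r*2..r*3} \<subseteq> {r*2..r*4} \<inter> {..<2*pi} \<inter> {..pi}"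
      using assms pi_gt3 by (auto)
    with sub show ?thesis by blast
  qed
  then have "measure lborel {r*2..r*3} \<le> measure lborel ({0..<2*pi} \<inter> cis -` ?S)"
    using S measurable_sets[OF cis_measurable_sphere, of ?S]
    by (intro measure_mono_fmeasurable) (auto simp: sets_circle_measure intro!: fmeasurableI emeasure_bounded_finite)
  then have "r \<le> measure lborel ({0..<2*pi} \<inter> cis -` ?S)" using assms by simp
  then have "r / (2*pi) \<le> measure circle_measure ?S"
    unfolding measure_circle_measure[OF S] by (rule divide_right_mono) simp
  moreover have "r / 8 \<le> r / (2*pi)"
    using assms pi_less_4 by (intro divide_left_mono) auto
  ultimately show ?thesis by linarith
qed

section \<open>Vanishing mean oscillation\<close>

lemma cnj_measurable [measurable]: "cnj \<in> borel_measurable borel"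
  by (intro borel_measurable_continuous_onI continuous_intros)

text \<open>For distinct exponents the integrand has an antiderivative of period 2 pi, because k - l
  is a nonzero integer.\<close>

lemma integral_circle_power_cnj:
  "(LINT z|circle_measure. z ^ k * cnj (z ^ l)) = (if k = l then 1 else 0)"
proof (cases "k = l")
  case True
  have "(LINT z|circle_measure. z ^ k * cnj (z ^ l)) = (LINT z|circle_measure. (1::complex))"
    using True by (intro Bochner_Integration.integral_cong refl)
      (simp add: complex_norm_square[symmetric] norm_power del: complex_cnj_power)
  then show ?thesis using True circle.prob_space by simp
next
  case False
  define m where "m = real k - real l"
  have m0: "m \<noteq> 0" using False by (simp add: m_def)
  have "(LBINT t=ereal 0..ereal (2*pi). cis (m * t)) = cis (m * (2*pi)) / (\<i> * of_real m) - cis (m * 0) / (\<i> * of_real m)"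
  proof (rule interval_integral_FTC_finite)
    show "continuous_on {min 0 (2*pi)..max 0 (2*pi)} (\<lambda>t. cis (m * t))"
      by (intro continuous_intros)
    fix t
    have "((\<lambda>t. cis (m * t)) has_vector_derivative \<i> * of_real m * cis (m * t))
        (at t within {min 0 (2*pi)..max 0 (2*pi)})"
      unfolding has_vector_derivative_def
      by (auto intro!: derivative_eq_intros simp: fun_eq_iff scaleR_conv_of_real)
    from has_vector_derivative_divide[OF this, of "\<i> * of_real m"]
    show "((\<lambda>t. cis (m * t) / (\<i> * of_real m)) has_vector_derivative cis (m * t))
       (at t within {min 0 (2*pi)..max 0 (2*pi)})"
      using m0 by simp
  qed
  also have "cis (m * (2*pi)) = 1"
    using cis_multiple_2pi[of m] by (simp add: m_def mult.commute)
  finally have 0: "(LBINT t=ereal 0..ereal (2*pi). cis (m * t)) = 0" by simp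
  have "(LINT z|circle_measure. z ^ k * cnj (z ^ l))
      = (LINT t:{0..<2*pi}|lborel. cis t ^ k * cnj (cis t ^ l)) /\<^sub>R (2*pi)"
    by (intro integral_circle_measure measurable_circle_measure) measurable
  also have "(LINT t:{0..<2*pi}|lborel. cis t ^ k * cnj (cis t ^ l)) = (LINT t:{0..<2*pi}|lborel. cis (m * t))"
  proof -
    have "cis t ^ k * cnj (cis t ^ l) = cis (m * t)" for t
      unfolding Complex.DeMoivre cis_cnj cis_mult by (simp add: m_def algebra_simps)
    then show ?thesis by simp
  qed
  also have "\<dots> = (LBINT t=ereal 0..ereal (2*pi). cis (m * t))"
    by (simp add: interval_integral_Ico)
  finally show ?thesis using 0 False by simp
qed

section \<open>Arcs: measurability, length and diameter\<close>

lemma arc_measurable: "is_arc I \<Longrightarrow> I \<in> sets circle_measure"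
  unfolding is_arc_def
  by (auto simp: sets_circle_measure sets_restrict_space space_restrict_space
      intro!: image_eqI[where x="cis ` _"] borel_closed compact_imp_closed compact_continuous_image
        continuous_intros)

lemma cis_diff_2pi: "cis (t - 2 * pi * of_int k) = cis t"
  using cis_multiple_2pi[of "of_int k"] by (simp flip: cis_divide)

lemma measure_arc_ge:
  assumes "a < b" "b \<le> a + 2*pi"
  shows "(b - a) / (2*pi) \<le> measure circle_measure (cis ` {a..b})"
proof -
  define k where "k = \<lfloor>a / (2*pi)\<rfloor>"
  define a' b' where "a' = a - 2*pi* of_int k" and "b' = b - 2*pi* of_int k"
  have a': "0 \<le> a'" "a' < 2*pi"
    using floor_divide_lower[of "2*pi" a] floor_divide_upper[of "2*pi" a]
    by (auto simp: a'_def k_def algebra_simps)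
  have b': "b' - a' = b - a" "a' < b'" "b' - 2*pi \<le> a'"
    using assms by (auto simp: a'_def b'_def)
  have I: "cis ` {a..b} \<in> sets circle_measure"
    using assms by (intro arc_measurable) (auto simp: is_arc_def)
  \<comment> \<open>After the shift the arc starts in [0, 2 pi) but may wrap past 2 pi, whence two
    pieces; they are disjoint because b' - 2 pi is at most a'.\<close>
  have "{a'..<min b' (2*pi)} \<union> {0..<b' - 2*pi} \<subseteq> {0..<2*pi} \<inter> cis -` cis ` {a..b}"
  proof
    fix t assume "t \<in> {a'..<min b' (2*pi)} \<union> {0..<b' - 2*pi}"
    then show "t \<in> {0..<2*pi} \<inter> cis -` cis ` {a..b}"
    proof
      assume t: "t \<in> {a'..<min b' (2*pi)}"
      then have "t + 2*pi* of_int k \<in> {a..b}" by (auto simp: a'_def b'_def)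
      moreover have "cis (t + 2*pi* of_int k) = cis t" 
        using cis_diff_2pi[of "t + 2*pi* of_int k" k] by simp
      ultimately show ?thesis using t a' by (auto intro!: image_eqI[where x="t + 2*pi* of_int k"])
    next
      assume t: "t \<in> {0..<b' - 2*pi}"
      then have "t + 2*pi* of_int (k+1) \<in> {a..b}" 
        using a' b' by (auto simp: a'_def b'_def algebra_simps)
      moreover have "cis (t + 2*pi* of_int (k+1)) = cis t" 
        using cis_diff_2pi[of "t + 2*pi* of_int (k+1)" "k+1"] by simp
      ultimately show ?thesis using t a' b' by (auto intro!: image_eqI[where x="t + 2*pi* of_int (k+1)"])
    qed
  qed
  then have "measure lborel ({a'..<min b' (2*pi)} \<union> {0..<b' - 2*pi}) \<le> measure lborel ({0..<2*pi} \<inter> cis -` cis ` {a..b})"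
    using I measurable_sets[OF cis_measurable_sphere, of "cis ` {a..b}"]
    by (intro measure_mono_fmeasurable) (auto simp: sets_circle_measure intro!: fmeasurableI emeasure_bounded_finite)
  moreover have "measure lborel ({a'..<min b' (2*pi)} \<union> {0..<b' - 2*pi})
      = measure lborel {a'..<min b' (2*pi)} + measure lborel {0..<b' - 2*pi}"
    using b' emeasure_bounded_finite[of "{a'..<min b' (2*pi)}"] emeasure_bounded_finite[of "{0..<b'-2*pi}"]
    by (intro measure_Union) auto
  moreover have "\<dots> = b - a" using a' b' by (cases "b' \<le> 2*pi") auto
  ultimately have "b - a \<le> measure lborel ({0..<2*pi} \<inter> cis -` cis ` {a..b})" by linarith
  then show ?thesis
    unfolding measure_circle_measure[OF I] by (rule divide_right_mono) simp
qed

lemma arc_measure_pos: "is_arc I \<Longrightarrow> 0 < measure circle_measure I"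
  unfolding is_arc_def using measure_arc_ge
  by (metis (no_types, opaque_lifting) diff_gt_0_iff_gt divide_pos_pos less_le_trans pi_gt_zero zero_less_mult_iff zero_less_numeral)

text \<open>VMO measures the smallness of an arc by its measure, continuity by its diameter; this
  bound links the two.\<close>

lemma arc_dist_le:
  assumes "is_arc I" "z \<in> I" "w \<in> I"
  shows "cmod (z - w) \<le> 2 * pi * measure circle_measure I"
proof -
  obtain a b where ab: "a < b" "b \<le> a + 2*pi" "I = cis ` {a..b}"
    using assms(1) by (auto simp: is_arc_def)
  obtain s t where st: "s \<in> {a..b}" "t \<in> {a..b}" "z = cis s" "w = cis t"
    using assms ab by auto
  have "cmod (z - w) \<le> \<bar>s - t\<bar>" unfolding st by (rule norm_cis_diff_le)
  also have "\<dots> \<le> b - a" using st by auto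
  also have "\<dots> \<le> 2 * pi * measure circle_measure I"
    using measure_arc_ge[OF ab(1,2)] by (simp add: ab field_simps)
  finally show ?thesis .
qed

lemma arc_subset_sphere: "is_arc I \<Longrightarrow> I \<subseteq> sphere 0 1"
  by (auto simp: is_arc_def)

lemma set_integrable_circle:
  fixes f :: "complex \<Rightarrow> 'b::{banach, second_countable_topology}"
  shows "integrable circle_measure f \<Longrightarrow> A \<in> sets circle_measure \<Longrightarrow> set_integrable circle_measure A f"
  unfolding set_integrable_def by (rule integrable_mult_indicator)

lemma set_integral_const_circle:
  fixes c :: "'b::{banach, second_countable_topology}"
  shows "I \<in> sets circle_measure \<Longrightarrow> (LINT z:I|circle_measure. c) = measure circle_measure I *\<^sub>R c"
  using sets.sets_into_space[of I circle_measure]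
  unfolding set_lebesgue_integral_def
  by (subst integral_scaleR_left) (auto simp: Int_absorb2 less_top[symmetric] intro!: integrable_real_indicator)

text \<open>The mean of f differs from c by at most the mean of |f - c|, so replacing the mean by
  any constant costs a factor 2.\<close>

lemma mean_osc_le:
  assumes I: "is_arc I" and f: "integrable circle_measure f"
  shows "mean_osc f I \<le> 2 * (LINT z:I|circle_measure. cmod (f z - c)) / measure circle_measure I"
proof -
  let ?m = "measure circle_measure I" and ?J = "LINT z:I|circle_measure. cmod (f z - c)"
  have m: "0 < ?m" using I by (rule arc_measure_pos)
  have Is: "I \<in> sets circle_measure" using I by (rule arc_measurable)
  have fc: "set_integrable circle_measure I (\<lambda>z. f z - d)" for d
    using f Is by (intro set_integrable_circle) auto
  have nc: "set_integrable circle_measure I (\<lambda>z. cmod (f z - d))" for d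
    using f Is by (intro set_integrable_circle) auto
  have const: "set_integrable circle_measure I (\<lambda>z. d)" for d :: "'b::{banach, second_countable_topology}"
    using Is by (intro set_integrable_circle) auto
  have "(LINT z:I|circle_measure. f z - c) = (LINT z:I|circle_measure. f z) - ?m *\<^sub>R c"
    using f Is by (subst set_integral_diff) (auto intro!: set_integrable_circle simp: set_integral_const_circle)
  then have "arc_mean f I - c = (LINT z:I|circle_measure. f z - c) /\<^sub>R ?m"
    using m by (simp add: arc_mean_def scaleR_diff_right)
  then have "cmod (arc_mean f I - c) = cmod (LINT z:I|circle_measure. f z - c) / ?m"
    using m by (simp add: divide_inverse mult.commute)
  also have "\<dots> \<le> ?J / ?m"
    using m set_integral_norm_bound[OF fc] by (simp add: divide_right_mono)
  finally have mean: "cmod (arc_mean f I - c) * ?m \<le> ?J" using m by (simp add: field_simps)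
  have "(LINT z:I|circle_measure. cmod (f z - arc_mean f I))
      \<le> (LINT z:I|circle_measure. cmod (f z - c) + cmod (arc_mean f I - c))"
    using nc const
    by (intro set_integral_mono set_integral_add) (auto intro: order_trans[OF _ norm_triangle_ineq4])
  also have "\<dots> = ?J + cmod (arc_mean f I - c) * ?m"
    using nc const Is by (subst set_integral_add) (auto simp: set_integral_const_circle)
  also have "\<dots> \<le> 2 * ?J" using mean by simp
  finally show ?thesis
    using m by (simp add: mean_osc_def divide_right_mono)
qed

text \<open>A working form of VMO: the mean is replaced by a constant chosen freely for each arc,
  which makes sums and explicit estimates immediate. Bounded mean oscillation is not demanded, as it
  follows.\<close>

definition vanishing_osc :: "(complex \<Rightarrow> complex) \<Rightarrow> bool" where
  "vanishing_osc f \<longleftrightarrow> integrable circle_measure f \<and>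
     (\<forall>\<epsilon>>0. \<exists>\<delta>>0. \<forall>I. is_arc I \<and> measure circle_measure I < \<delta> \<longrightarrow>
        (\<exists>c. (LINT z:I|circle_measure. cmod (f z - c)) \<le> \<epsilon> * measure circle_measure I))"

text \<open>Short arcs are handled by the hypothesis; on arcs of measure at least
  \<open>\<delta>\<close> the oscillation is at most twice the L1 norm over \<open>\<delta>\<close>,
  and this gives BMO.\<close>

lemma vanishing_osc_imp_VMO:
  assumes "vanishing_osc f"
  shows "f \<in> VMO"
proof -
  have f: "integrable circle_measure f" using assms by (simp add: vanishing_osc_def)
  have small: "\<exists>\<delta>>0. \<forall>I. is_arc I \<and> measure circle_measure I < \<delta> \<longrightarrow> mean_osc f I < \<epsilon>"
    if "\<epsilon> > 0" for \<epsilon>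
  proof -
    \<comment> \<open>The third of \<open>\<epsilon>\<close> pays for the factor 2 in
      \<open>mean_osc_le\<close> and keeps the final inequality strict.\<close>
    obtain \<delta> where d: "\<delta> > 0" "\<And>I. is_arc I \<Longrightarrow> measure circle_measure I < \<delta> \<Longrightarrow>
        \<exists>c. (LINT z:I|circle_measure. cmod (f z - c)) \<le> \<epsilon>/3 * measure circle_measure I"
      using assms \<open>\<epsilon> > 0\<close> unfolding vanishing_osc_def by (metis zero_less_divide_iff zero_less_numeral)
    have "mean_osc f I < \<epsilon>" if I: "is_arc I" "measure circle_measure I < \<delta>" for I
    proof -
      obtain c where c: "(LINT z:I|circle_measure. cmod (f z - c)) \<le> \<epsilon>/3 * measure circle_measure I"
        using d(2)[OF I] by blast
      have "mean_osc f I \<le> 2 * (LINT z:I|circle_measure. cmod (f z - c)) / measure circle_measure I"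
        by (rule mean_osc_le[OF I(1) f])
      also have "\<dots> \<le> 2 * \<epsilon> / 3"
        using c arc_measure_pos[OF I(1)] by (simp add: field_simps)
      also have "\<dots> < \<epsilon>" using \<open>\<epsilon> > 0\<close> by simp
      finally show ?thesis .
    qed
    with d(1) show ?thesis by blast
  qed
  obtain \<delta> where d: "\<delta> > 0" "\<And>I. is_arc I \<Longrightarrow> measure circle_measure I < \<delta> \<Longrightarrow> mean_osc f I < 1"
    using small[of 1] by auto
  have "mean_osc f I \<le> max 1 (2 * (LINT z|circle_measure. cmod (f z)) / \<delta>)" if I: "is_arc I" for I
  proof (cases "measure circle_measure I < \<delta>")
    case True
    then show ?thesis using d(2)[OF I] by simp
  next
    case False
    have "mean_osc f I \<le> 2 * (LINT z:I|circle_measure. cmod (f z - 0)) / measure circle_measure I"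
      by (rule mean_osc_le[OF I f])
    also have "\<dots> \<le> 2 * (LINT z|circle_measure. cmod (f z)) / \<delta>"
    proof (intro frac_le mult_left_mono)
      show "(LINT z:I|circle_measure. cmod (f z - 0)) \<le> (LINT z|circle_measure. cmod (f z))"
        unfolding set_lebesgue_integral_def using f arc_measurable[OF I]
        by (intro integral_mono integrable_mult_indicator) (auto simp: indicator_def)
    qed (use False d(1) in auto)
    finally show ?thesis by simp
  qed
  then have "f \<in> BMO" unfolding BMO_def using f by (auto intro!: bdd_aboveI2)
  then show ?thesis unfolding VMO_def using small by auto
qed

lemma vanishing_osc_add:
  assumes f: "vanishing_osc f" and g: "vanishing_osc g"
  shows "vanishing_osc (\<lambda>z. f z + g z)"
  unfolding vanishing_osc_def
proof (intro conjI allI impI)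
  have fi: "integrable circle_measure f" and gi: "integrable circle_measure g"
    using f g by (auto simp: vanishing_osc_def)
  then show "integrable circle_measure (\<lambda>z. f z + g z)" by simp
  fix \<epsilon> :: real assume "\<epsilon> > 0"
  then have e2: "\<epsilon>/2 > 0" by simp
  obtain d1 where d1: "d1 > 0" "\<And>I. is_arc I \<Longrightarrow> measure circle_measure I < d1 \<Longrightarrow>
      \<exists>c. (LINT z:I|circle_measure. cmod (f z - c)) \<le> \<epsilon>/2 * measure circle_measure I"
    using f e2 unfolding vanishing_osc_def by blast
  obtain d2 where d2: "d2 > 0" "\<And>I. is_arc I \<Longrightarrow> measure circle_measure I < d2 \<Longrightarrow>
      \<exists>c. (LINT z:I|circle_measure. cmod (g z - c)) \<le> \<epsilon>/2 * measure circle_measure I"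
    using g e2 unfolding vanishing_osc_def by blast
  show "\<exists>\<delta>>0. \<forall>I. is_arc I \<and> measure circle_measure I < \<delta> \<longrightarrow>
        (\<exists>c. (LINT z:I|circle_measure. cmod (f z + g z - c)) \<le> \<epsilon> * measure circle_measure I)"
  proof (intro exI[of _ "min d1 d2"] conjI allI impI)
    show "min d1 d2 > 0" using d1(1) d2(1) by simp
    fix I assume I: "is_arc I \<and> measure circle_measure I < min d1 d2"
    obtain c where c: "(LINT z:I|circle_measure. cmod (f z - c)) \<le> \<epsilon>/2 * measure circle_measure I"
      using d1(2)[of I] I by auto
    obtain d where d: "(LINT z:I|circle_measure. cmod (g z - d)) \<le> \<epsilon>/2 * measure circle_measure I"
      using d2(2)[of I] I by auto
    have Is: "I \<in> sets circle_measure" using I arc_measurable by blast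
    have fI: "set_integrable circle_measure I (\<lambda>z. cmod (f z - c))"
      and gI: "set_integrable circle_measure I (\<lambda>z. cmod (g z - d))"
      and fgI: "set_integrable circle_measure I (\<lambda>z. cmod (f z + g z - (c + d)))"
      using fi gi Is by (auto intro!: set_integrable_circle)
    have "(LINT z:I|circle_measure. cmod (f z + g z - (c + d)))
        \<le> (LINT z:I|circle_measure. cmod (f z - c) + cmod (g z - d))"
      using fI gI fgI by (intro set_integral_mono set_integral_add norm_diff_triangle_ineq)
    also have "\<dots> \<le> \<epsilon> * measure circle_measure I"
      using c d by (subst set_integral_add(2)[OF fI gI]) (simp add: field_simps)
    finally show "\<exists>c. (LINT z:I|circle_measure. cmod (f z + g z - c)) \<le> \<epsilon> * measure circle_measure I"
      by blast
  qed
qed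

lemma vanishing_osc_uminus:
  assumes "vanishing_osc f"
  shows "vanishing_osc (\<lambda>z. - f z)"
  unfolding vanishing_osc_def
proof (intro conjI allI impI)
  show "integrable circle_measure (\<lambda>z. - f z)"
    using assms by (simp add: vanishing_osc_def)
  have eq: "cmod (- w - (- c)) = cmod (w - c)" for w c
    by (metis minus_diff_minus norm_minus_cancel)
  fix \<epsilon> :: real assume "\<epsilon> > 0"
  then obtain \<delta> where d: "\<delta> > 0" "\<And>I. is_arc I \<Longrightarrow> measure circle_measure I < \<delta> \<Longrightarrow>
      \<exists>c. (LINT z:I|circle_measure. cmod (f z - c)) \<le> \<epsilon> * measure circle_measure I"
    using assms unfolding vanishing_osc_def by blast
  have "\<exists>c. (LINT z:I|circle_measure. cmod (- f z - c)) \<le> \<epsilon> * measure circle_measure I"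
    if I: "is_arc I" "measure circle_measure I < \<delta>" for I
  proof -
    obtain c where "(LINT z:I|circle_measure. cmod (f z - c)) \<le> \<epsilon> * measure circle_measure I"
      using d(2)[OF I] by blast
    then show ?thesis by (intro exI[of _ "-c"]) (simp only: eq)
  qed
  with d(1) show "\<exists>\<delta>>0. \<forall>I. is_arc I \<and> measure circle_measure I < \<delta> \<longrightarrow>
        (\<exists>c. (LINT z:I|circle_measure. cmod (- f z - c)) \<le> \<epsilon> * measure circle_measure I)"
    by blast
qed

lemma continuous_imp_vanishing_osc:
  assumes meas: "f \<in> borel_measurable circle_measure" and cont: "continuous_on (sphere 0 1) f"
  shows "vanishing_osc f"
  unfolding vanishing_osc_def
proof (intro conjI allI impI)
  have "compact (f ` sphere 0 1)" by (intro compact_continuous_image cont) simp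
  then obtain B where B: "\<And>z. z \<in> sphere 0 1 \<Longrightarrow> cmod (f z) \<le> B"
    using compact_imp_bounded bounded_iff by (metis imageI)
  then show fi: "integrable circle_measure f"
    by (intro circle.integrable_const_bound[of _ B] AE_I2 meas) auto
  fix \<epsilon> :: real assume e: "\<epsilon> > 0"
  have "uniformly_continuous_on (sphere 0 1) f"
    by (intro compact_uniformly_continuous cont) simp
  then obtain d where d: "d > 0" "\<And>z w. z \<in> sphere 0 1 \<Longrightarrow> w \<in> sphere 0 1 \<Longrightarrow> cmod (z - w) < d \<Longrightarrow> cmod (f z - f w) < \<epsilon>"
    using e unfolding uniformly_continuous_on_def dist_norm by metis
  show "\<exists>\<delta>>0. \<forall>I. is_arc I \<and> measure circle_measure I < \<delta> \<longrightarrow>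
        (\<exists>c. (LINT z:I|circle_measure. cmod (f z - c)) \<le> \<epsilon> * measure circle_measure I)"
  proof (intro exI[of _ "d / (2*pi)"] conjI allI impI)
    show "d / (2*pi) > 0" using d(1) by simp
    fix I assume I: "is_arc I \<and> measure circle_measure I < d / (2*pi)"
    then have "I \<noteq> {}" by (auto simp: is_arc_def)
    then obtain w where w: "w \<in> I" by blast
    have Is: "I \<in> sets circle_measure" using I arc_measurable by blast
    have lt: "2 * pi * measure circle_measure I < d" using I by (simp add: field_simps)
    have "(LINT z:I|circle_measure. cmod (f z - f w)) \<le> (LINT z:I|circle_measure. \<epsilon>)"
    proof (rule set_integral_mono)
      fix z assume "z \<in> I"
      then have "cmod (f z - f w) < \<epsilon>"
        using arc_dist_le[of I z w] arc_subset_sphere[of I] w I lt by (intro d(2)) auto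
      then show "cmod (f z - f w) \<le> \<epsilon>" by simp
    qed (use fi Is in \<open>auto intro!: set_integrable_circle\<close>)
    also have "\<dots> = \<epsilon> * measure circle_measure I" using Is by (simp add: set_integral_const_circle)
    finally show "\<exists>c. (LINT z:I|circle_measure. cmod (f z - c)) \<le> \<epsilon> * measure circle_measure I"
      by blast
  qed
qed

section \<open>The logarithm of the distance to 1\<close>

text \<open>\<open>ln (D / s)\<close> is at most the number of \<open>k\<close> with \<open>s \<le> D / 2 ^ k\<close>.\<close>

lemma nn_integral_ln_near_one:
  assumes "0 < D"
  shows "(\<integral>\<^sup>+z. ennreal (ln (D / cmod (1 - z))) * indicator {z. cmod (1 - z) \<le> D} z \<partial>circle_measure)
    \<le> ennreal (2 * D)"
proof -
  let ?A = "\<lambda>k::nat. {z\<in>sphere 0 1. cmod (1 - z) \<le> D * (1/2)^k}"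
  have A: "?A k \<in> sets circle_measure" for k
    by (rule sets_circle_measure_Collect) measurable
  have pt: "ennreal (ln (D / cmod (1 - z))) * indicator {z. cmod (1 - z) \<le> D} z \<le> (\<Sum>k. indicator (?A k) z)"
    if z: "z \<in> sphere 0 1" for z
  proof (cases "0 < cmod (1 - z) \<and> cmod (1 - z) \<le> D")
    case True
    define y where "y = D / cmod (1 - z)"
    have y: "1 \<le> y" using True by (simp add: y_def)
    \<comment> \<open>This is the number of k with 2^k at most y, that is, of the sets
      \<open>?A k\<close> that contain z.\<close>
    define n where "n = nat \<lfloor>log 2 y\<rfloor> + 1"
    have lg: "0 \<le> log 2 y" using y by (simp add: zero_le_log_cancel_iff)
    have "ln y * ln 2 \<le> ln y * 1" using y ln_le_minus_one[of 2] by (intro mult_left_mono) auto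
    then have "ln y \<le> log 2 y" by (simp add: log_def field_simps)
    also have "\<dots> \<le> real n" using lg by (simp add: n_def) linarith
    finally have "ln y \<le> real n" .
    then have "ennreal (ln y) \<le> of_nat n" by (metis ennreal_leI ennreal_of_nat_eq_real_of_nat)
    also have "\<dots> = (\<Sum>k<n. 1)" by simp
    also have "\<dots> = (\<Sum>k<n. indicator (?A k) z)"
    proof (intro sum.cong refl)
      fix k assume "k \<in> {..<n}"
      then have "real k \<le> log 2 y" using lg by (simp add: n_def le_nat_iff) linarith
      then have "2 powr real k \<le> y" using y by (simp add: le_log_iff)
      then have "2 ^ k \<le> y" by (simp add: powr_realpow)
      then have "cmod (1 - z) \<le> D * (1/2)^k"
        using True by (simp add: y_def field_simps power_divide)
      then show "1 = indicator (?A k) z" using z by simp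
    qed
    also have "\<dots> \<le> (\<Sum>k. indicator (?A k) z)" by (intro sum_le_suminf) auto
    finally show ?thesis using True by (simp add: y_def)
  next
    case False
    \<comment> \<open>At z = 1 division by zero gives \<open>ln 0 = 0\<close>, so the left side
      vanishes there as well.\<close>
    then have "cmod (1 - z) = 0 \<or> D < cmod (1 - z)" by auto
    then show ?thesis by auto
  qed
  have "(\<integral>\<^sup>+z. ennreal (ln (D / cmod (1 - z))) * indicator {z. cmod (1 - z) \<le> D} z \<partial>circle_measure)
      \<le> (\<integral>\<^sup>+z. (\<Sum>k. indicator (?A k) z) \<partial>circle_measure)"
    using pt by (intro nn_integral_mono) simp
  also have "\<dots> = (\<Sum>k. emeasure circle_measure (?A k))"
    using A by (subst nn_integral_suminf) auto
  also have "\<dots> \<le> (\<Sum>k. ennreal (D * (1/2)^k))"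
    using assms measure_circle_near_one
    by (intro suminf_le summableI) (auto simp: circle.emeasure_eq_measure intro!: ennreal_leI)
  also have "\<dots> = ennreal (2 * D)"
  proof (rule suminf_ennreal_eq)
    have "(\<lambda>k. D * (1/2)^k) sums (D * (1 / (1 - 1/2)))" by (intro sums_mult geometric_sums) simp
    then show "(\<lambda>k. D * (1/2)^k) sums (2 * D)" by (simp add: mult.commute)
  qed (use assms in auto)
  finally show ?thesis .
qed

text \<open>The bound is linear in D, so on an arc whose length is comparable with D the average of
  ln (D / |1 - z|) is bounded.\<close>

lemma integral_ln_near_one:
  assumes D: "0 < D" and A: "A \<in> sets circle_measure" and sub: "\<And>z. z \<in> A \<Longrightarrow> cmod (1 - z) \<le> D"
  shows "set_integrable circle_measure A (\<lambda>z. ln (D / cmod (1 - z)))"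
    and "(LINT z:A|circle_measure. ln (D / cmod (1 - z))) \<le> 2 * D"
proof -
  have [measurable]: "(\<lambda>z. ln (D / cmod (1 - z))) \<in> borel_measurable circle_measure"
    by (rule measurable_circle_measure) measurable
  have pos: "0 \<le> indicator A z *\<^sub>R ln (D / cmod (1 - z))" for z
    using sub[of z] D by (cases "cmod (1 - z) = 0") (auto simp: indicator_def)
  have "(\<integral>\<^sup>+z. ennreal (indicator A z *\<^sub>R ln (D / cmod (1 - z))) \<partial>circle_measure)
     \<le> (\<integral>\<^sup>+z. ennreal (ln (D / cmod (1 - z))) * indicator {z. cmod (1 - z) \<le> D} z \<partial>circle_measure)"
    using sub by (intro nn_integral_mono) (auto simp: indicator_def)
  also have "\<dots> \<le> ennreal (2 * D)" using D by (rule nn_integral_ln_near_one)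
  finally have b: "(\<integral>\<^sup>+z. ennreal (indicator A z *\<^sub>R ln (D / cmod (1 - z))) \<partial>circle_measure) \<le> ennreal (2 * D)" .
  show "set_integrable circle_measure A (\<lambda>z. ln (D / cmod (1 - z)))"
    unfolding set_integrable_def
    by (rule integrableI_nonneg) (use A b pos in \<open>auto intro: le_less_trans\<close>)
  show "(LINT z:A|circle_measure. ln (D / cmod (1 - z))) \<le> 2 * D"
    unfolding set_lebesgue_integral_def by (rule integral_real_bounded) (use D b in auto)
qed

text \<open>For \<open>z \<noteq> 1\<close> this is \<open>2 - log 2 (cmod (1 - z))\<close>. The form below takes the value 1 at \<open>z = 1\<close>
  (as \<open>log 2 0 = 0\<close>), so that its logarithm vanishes there.\<close>

definition log_height :: "complex \<Rightarrow> real" where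
  "log_height z = 1 - log 2 (cmod (1 - z) / 2)"

lemma log_height_measurable [measurable]: "log_height \<in> borel_measurable borel"
  unfolding log_height_def by measurable

lemma norm_1_minus_le_2: "z \<in> sphere 0 1 \<Longrightarrow> cmod (1 - z) \<le> 2"
  using norm_triangle_ineq4[of 1 z] by simp

lemma log_height_ge_1: "z \<in> sphere 0 1 \<Longrightarrow> 1 \<le> log_height z"
  using norm_1_minus_le_2[of z] by (cases "z = 1") (auto simp: log_height_def, simp add: log_def)

lemma log_height_eq: "z \<noteq> 1 \<Longrightarrow> log_height z = 2 - log 2 (cmod (1 - z))"
  by (simp add: log_height_def log_divide)

lemma AE_circle_not_1: "AE z in circle_measure. z \<noteq> 1"
proof -
  have "measure circle_measure {z\<in>sphere 0 1. cmod (1 - z) \<le> 0} = 0"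
    using measure_circle_near_one[of 0] by (simp add: measure_le_0_iff)
  then have "emeasure circle_measure {z\<in>sphere 0 1. cmod (1 - z) \<le> 0} = 0"
    by (simp add: circle.emeasure_eq_measure)
  then show ?thesis
    by (intro AE_I[of _ _ "{z\<in>sphere 0 1. cmod (1 - z) \<le> 0}"] sets_circle_measure_Collect) auto
qed

lemma log_height_integrable: "integrable circle_measure log_height"
proof -
  have "set_integrable circle_measure (sphere 0 1) (\<lambda>z. ln (2 / cmod (1 - z)))"
    using sets.top[of circle_measure] norm_1_minus_le_2 by (intro integral_ln_near_one) auto
  then have i: "integrable circle_measure (\<lambda>z. ln (2 / cmod (1 - z)))"
    unfolding set_integrable_def
    by (rule Bochner_Integration.integrable_cong[THEN iffD1, rotated -1]) auto
  have eq: "AE z in circle_measure. 1 + ln (2 / cmod (1 - z)) / ln 2 = log_height z"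
    using AE_circle_not_1
  proof eventually_elim
    case (elim z)
    then show ?case by (simp add: log_height_eq log_def ln_div diff_divide_distrib)
  qed
  have "integrable circle_measure (\<lambda>z. 1 + ln (2 / cmod (1 - z)) / ln 2)"
    using i by simp
  then show ?thesis
    by (rule integrable_cong_AE_imp) (use eq in \<open>auto intro!: measurable_circle_measure\<close>)
qed

text \<open>From ln (a / b) \<le> a / b - 1: the heights differ by log 2 (D / s) with s = |1 - z|,
  and the outer logarithm divides this by the height at distance D. That divisor tends to infinity
  as D -> 0, which makes the oscillation vanish and not merely stay bounded. The factor 2 bounds 1 /
  ln 2.\<close>

lemma ln_log_height_diff:
  assumes "z \<noteq> 1" "cmod (1 - z) \<le> D" "D \<le> 2"
  shows "0 \<le> ln (log_height z) - ln (2 - log 2 D)"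
    and "ln (log_height z) - ln (2 - log 2 D) \<le> 2 * ln (D / cmod (1 - z)) / (2 - log 2 D)"
proof -
  define s where "s = cmod (1 - z)"
  have s: "0 < s" "s \<le> D" using assms by (auto simp: s_def)
  have D1: "1 \<le> 2 - log 2 D" using assms(3) s by (simp add: log_le_one_cancel_iff)
  have h: "log_height z = 2 - log 2 s" using assms(1) by (simp add: log_height_eq s_def)
  have le: "2 - log 2 D \<le> log_height z" using s by (simp add: h)
  then show "0 \<le> ln (log_height z) - ln (2 - log 2 D)" using D1 by simp
  have ln2: "1/2 \<le> ln (2::real)" using ln2_ge_two_thirds by simp
  have "ln (log_height z) - ln (2 - log 2 D) = ln (log_height z / (2 - log 2 D))"
    using le D1 by (simp add: ln_div)
  also have "\<dots> \<le> log_height z / (2 - log 2 D) - 1" using le D1 by (intro ln_le_minus_one) auto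
  also have "\<dots> = (log 2 D - log 2 s) / (2 - log 2 D)" using D1 by (simp add: h field_simps)
  also have "\<dots> = (ln (D / s) / ln 2) / (2 - log 2 D)" using s by (simp add: log_def ln_div diff_divide_distrib)
  also have "\<dots> \<le> (2 * ln (D / s)) / (2 - log 2 D)"
  proof (intro divide_right_mono)
    have "ln (D/s) * 1 \<le> ln (D/s) * (2 * ln 2)" using s ln2 by (intro mult_left_mono) auto
    then show "ln (D / s) / ln 2 \<le> 2 * ln (D / s)" by (simp add: field_simps)
  qed (use D1 in auto)
  finally show "ln (log_height z) - ln (2 - log 2 D) \<le> 2 * ln (D / cmod (1 - z)) / (2 - log 2 D)"
    by (simp add: s_def)
qed

text \<open>With D about the largest distance from the arc to 1 and x the height at distance D, the
  oscillation is at most the mean of (2 / x) ln (D / s). If the arc is long compared with D, the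
  mean of ln (D / s) is bounded and x is large. Otherwise ln (D / s) is of order l / D, which is
  small unless D is small, and then x is large again.\<close>

lemma vanishing_osc_ln_log_height: "vanishing_osc (\<lambda>z. complex_of_real (ln (log_height z)))"
  unfolding vanishing_osc_def
proof (intro conjI allI impI)
  have lnint: "integrable circle_measure (\<lambda>z. ln (log_height z))"
  proof (rule Bochner_Integration.integrable_bound[OF log_height_integrable])
    show "(\<lambda>z. ln (log_height z)) \<in> borel_measurable circle_measure"
      by (rule measurable_circle_measure) measurable
    show "AE z in circle_measure. norm (ln (log_height z)) \<le> norm (log_height z)"
      using log_height_ge_1 by (intro AE_I2) (force intro: order_trans[OF ln_le_minus_one])
  qed
  then show ci: "integrable circle_measure (\<lambda>z. complex_of_real (ln (log_height z)))" by simp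
  fix \<epsilon> :: real assume e: "\<epsilon> > 0"
  \<comment> \<open>A height above K makes 2 / x times the bounded averages below at most
    \<open>\<epsilon>\<close>; \<open>\<rho>\<close> is the distance to 1 below which this height is
    reached. The factor 64 * pi in \<open>\<delta>\<close> gives 32 * l < min \<open>\<rho>\<close>
    (\<open>\<epsilon> * \<rho>\<close>), as l = 2 * pi * m.\<close>
  define K where "K = 64 * pi / \<epsilon> + 2"
  define \<rho> where "\<rho> = 2 powr (- K)"
  define \<delta> where "\<delta> = min \<rho> (\<epsilon> * \<rho>) / (64 * pi)"
  have \<rho>: "0 < \<rho>" by (simp add: \<rho>_def)
  have key: "\<exists>c. (LINT z:I|circle_measure. cmod (complex_of_real (ln (log_height z)) - c)) \<le> \<epsilon> * measure circle_measure I"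
    if I: "is_arc I" and small: "measure circle_measure I < \<delta>" for I
  proof -
    define m where "m = measure circle_measure I"
    define l where "l = 2 * pi * m"
    have m: "0 < m" "m < \<delta>" using arc_measure_pos[OF I] small by (auto simp: m_def)
    have l: "0 < l" using m by (simp add: l_def)
    have l32: "32 * l < min \<rho> (\<epsilon> * \<rho>)" using m by (simp add: l_def \<delta>_def field_simps)
    have Is: "I \<in> sets circle_measure" using arc_measurable I by blast
    have "I \<noteq> {}" using I by (auto simp: is_arc_def)
    then obtain z0 where z0: "z0 \<in> I" by blast
    \<comment> \<open>An upper bound for the distance to 1 on the arc that is at most 2 * l above
      every such distance. The cap at 2, the diameter of the circle, ensures x \<ge> 1.\<close>
    define D where "D = min 2 (cmod (1 - z0) + l)"
    have D: "0 < D" "D \<le> 2" using l by (auto simp: D_def add_nonneg_pos)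
    have upper: "cmod (1 - z) \<le> D" and lower: "D - 2 * l \<le> cmod (1 - z)" if z: "z \<in> I" for z
    proof -
      have "cmod (z - z0) \<le> l" using arc_dist_le[OF I z z0] by (simp add: l_def m_def)
      moreover have "cmod (1 - z) \<le> cmod (1 - z0) + cmod (z - z0)"
        using norm_triangle_ineq4[of "1 - z0" "z - z0"] by (simp add: algebra_simps)
      moreover have "cmod (1 - z0) \<le> cmod (1 - z) + cmod (z - z0)"
        using norm_triangle_ineq[of "1 - z" "z - z0"] by (simp add: algebra_simps)
      moreover have "cmod (1 - z) \<le> 2" using arc_subset_sphere[OF I] z norm_1_minus_le_2 by blast
      ultimately show "cmod (1 - z) \<le> D" "D - 2 * l \<le> cmod (1 - z)"
        by (auto simp: D_def)
    qed
    define x where "x = 2 - log 2 D"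
    have x: "1 \<le> x" using D by (simp add: x_def)
    have logD: "log 2 D < - K" if "D < \<rho>"
    proof -
      have "log 2 D < log 2 \<rho>" using that D \<rho> by (subst log_less_cancel_iff) auto
      then show ?thesis by (simp add: \<rho>_def)
    qed
    have int: "set_integrable circle_measure I (\<lambda>z. ln (D / cmod (1 - z)))"
      and int_le: "(LINT z:I|circle_measure. ln (D / cmod (1 - z))) \<le> 2 * D"
      using integral_ln_near_one[OF D(1) Is upper] by auto
    have "(LINT z:I|circle_measure. cmod (complex_of_real (ln (log_height z)) - complex_of_real (ln x)))
        \<le> (LINT z:I|circle_measure. 2 / x * ln (D / cmod (1 - z)))"
    proof (rule set_integral_mono_AE)
      show "set_integrable circle_measure I (\<lambda>z. cmod (complex_of_real (ln (log_height z)) - complex_of_real (ln x)))"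
        using ci Is by (intro set_integrable_circle) auto
      show "set_integrable circle_measure I (\<lambda>z. 2 / x * ln (D / cmod (1 - z)))"
        using int by (rule set_integrable_mult_right)
      show "AE z\<in>I in circle_measure. cmod (complex_of_real (ln (log_height z)) - complex_of_real (ln x))
          \<le> 2 / x * ln (D / cmod (1 - z))"
        using AE_circle_not_1
      proof eventually_elim
        case (elim z)
        show ?case
        proof
          assume "z \<in> I"
          with ln_log_height_diff[OF elim upper[OF this] D(2)]
          show "cmod (complex_of_real (ln (log_height z)) - complex_of_real (ln x)) \<le> 2 / x * ln (D / cmod (1 - z))"
            by (simp add: x_def flip: of_real_diff)
        qed
      qed
    qed
    also have "\<dots> = 2 / x * (LINT z:I|circle_measure. ln (D / cmod (1 - z)))"
      by (rule set_integral_mult_right)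
    also have "\<dots> \<le> \<epsilon> * m"
    proof (cases "D < 4 * l")
      \<comment> \<open>The arc is long compared with D: the integral is at most 8 * l = 16 * pi *
        m, and D < 4 * l < \<open>\<rho>\<close> makes x large.\<close>
      case True
      have "D < \<rho>" using True l32 l by linarith
      then have "log 2 D < - K" using logD by blast
      then have xK: "64 * pi / \<epsilon> \<le> x" by (simp add: x_def K_def)
      have "2 / x * (LINT z:I|circle_measure. ln (D / cmod (1 - z))) \<le> 2 / x * (2 * (4 * l))"
        using x int_le True by (intro mult_left_mono) auto
      also have "\<dots> = 32 * pi * m / x" by (simp add: l_def)
      also have "\<dots> \<le> \<epsilon> * m"
      proof -
        have "64 * pi \<le> \<epsilon> * x" using xK e by (simp add: field_simps)
        then have "32 * pi \<le> \<epsilon> * x" using pi_gt_zero by linarith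
        then have "32 * pi * m \<le> (\<epsilon> * x) * m" using m by (intro mult_right_mono) auto
        then show ?thesis using x by (simp add: field_simps)
      qed
      finally show ?thesis .
    next
      \<comment> \<open>Now every point of the arc has distance at least D / 2 from 1, and ln (D /
        s) \<le> (D - s) / s applies.\<close>
      case False
      have lnle: "ln (D / cmod (1 - z)) \<le> 4 * l / D" if z: "z \<in> I" for z
      proof -
        have s: "D / 2 \<le> cmod (1 - z)" using lower[OF z] False by linarith
        then have s0: "0 < cmod (1 - z)" using D by linarith
        have "ln (D / cmod (1 - z)) \<le> D / cmod (1 - z) - 1" using D s0 by (intro ln_le_minus_one) simp
        also have "\<dots> = (D - cmod (1 - z)) / cmod (1 - z)" using s0 by (simp add: field_simps)
        also have "\<dots> \<le> (2 * l) / (D / 2)" using lower[OF z] l s D by (intro frac_le) auto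
        finally show ?thesis by simp
      qed
      have "(LINT z:I|circle_measure. ln (D / cmod (1 - z))) \<le> (LINT z:I|circle_measure. 4 * l / D)"
        using lnle Is by (intro set_integral_mono int set_integrable_circle[of "\<lambda>_. 4 * l / D"]) auto
      also have "\<dots> = m * (4 * l / D)" using Is by (simp add: set_integral_const_circle m_def)
      finally have le: "(LINT z:I|circle_measure. ln (D / cmod (1 - z))) \<le> m * (4 * l / D)" .
      have "2 / x * (LINT z:I|circle_measure. ln (D / cmod (1 - z))) \<le> 2 / x * (m * (4 * l / D))"
        using x le by (intro mult_left_mono) auto
      also have "\<dots> = (8 * l / (x * D)) * m" using x D by (simp add: field_simps)
      also have "\<dots> \<le> \<epsilon> * m"
      proof (rule mult_right_mono)
        show "8 * l / (x * D) \<le> \<epsilon>"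
        \<comment> \<open>Near 1 the quotient l / D is only at most 1/4 and the gain comes from x;
          away from 1 only x \<ge> 1 is used and l is small against
          \<open>\<epsilon> * \<rho>\<close>.\<close>
        proof (cases "D < \<rho>")
          case True
          then have "log 2 D < - K" using logD by blast
          then have "64 * pi / \<epsilon> + 4 \<le> x" by (simp add: x_def K_def)
          moreover have "2 / \<epsilon> \<le> 64 * pi / \<epsilon>" using e pi_gt3 by (intro divide_right_mono) auto
          ultimately have "2 / \<epsilon> \<le> x" by simp
          then have "2 \<le> \<epsilon> * x" using e by (simp add: field_simps)
          then have "2 * D \<le> (\<epsilon> * x) * D" using D by (intro mult_right_mono) auto
          then have "8 * l \<le> \<epsilon> * (x * D)" using False by (simp add: mult.assoc)
          then show ?thesis using x D by (simp add: divide_le_eq)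
        next
          case F: False
          have "8 * l \<le> \<epsilon> * \<rho>" using l32 l by linarith
          also have "\<dots> \<le> \<epsilon> * (x * D)"
          proof (rule mult_left_mono)
            have "1 * D \<le> x * D" using x D by (intro mult_right_mono) auto
            then show "\<rho> \<le> x * D" using F by simp
          qed (use e in auto)
          finally show ?thesis using x D by (simp add: divide_le_eq)
        qed
      qed (use m in auto)
      finally show ?thesis .
    qed
    finally show ?thesis unfolding m_def by blast
  qed
  moreover have "\<delta> > 0" using \<rho> e by (simp add: \<delta>_def)
  ultimately show "\<exists>\<delta>>0. \<forall>I. is_arc I \<and> measure circle_measure I < \<delta> \<longrightarrow>
        (\<exists>c. (LINT z:I|circle_measure. cmod (complex_of_real (ln (log_height z)) - c)) \<le> \<epsilon> * measure circle_measure I)"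
    by blast
qed

section \<open>Correlation of past and future\<close>

lemma vec_nth_measurable:
  "(\<lambda>v. v $ j) \<in> borel_measurable (borel :: ('b::{topological_space, second_countable_topology}^'d) measure)"
  by (intro borel_measurable_continuous_onI continuous_intros)

lemma integrable_mult_cnj:
  assumes "f \<in> borel_measurable M" "g \<in> borel_measurable M"
    and "integrable M (\<lambda>\<omega>. (cmod (f \<omega>))\<^sup>2)" "integrable M (\<lambda>\<omega>. (cmod (g \<omega>))\<^sup>2)"
  shows "integrable M (\<lambda>\<omega>. f \<omega> * cnj (g \<omega>))"
proof (rule Bochner_Integration.integrable_bound)
  show "integrable M (\<lambda>\<omega>. (cmod (f \<omega>))\<^sup>2 + (cmod (g \<omega>))\<^sup>2)" using assms by simp
  show "(\<lambda>\<omega>. f \<omega> * cnj (g \<omega>)) \<in> borel_measurable M" using assms by measurable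
  show "AE \<omega> in M. norm (f \<omega> * cnj (g \<omega>)) \<le> norm ((cmod (f \<omega>))\<^sup>2 + (cmod (g \<omega>))\<^sup>2)"
  proof (rule AE_I2)
    fix \<omega>
    have "2 * cmod (f \<omega>) * cmod (g \<omega>) \<le> (cmod (f \<omega>))\<^sup>2 + (cmod (g \<omega>))\<^sup>2" by (rule sum_squares_bound)
    moreover have "0 \<le> cmod (f \<omega>) * cmod (g \<omega>)" by simp
    ultimately have "cmod (f \<omega>) * cmod (g \<omega>) \<le> (cmod (f \<omega>))\<^sup>2 + (cmod (g \<omega>))\<^sup>2" by linarith
    then show "norm (f \<omega> * cnj (g \<omega>)) \<le> norm ((cmod (f \<omega>))\<^sup>2 + (cmod (g \<omega>))\<^sup>2)"
      by (simp add: norm_mult)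
  qed
qed

text \<open>In the unit ball the pointwise inequality 2 a b \<le> a^2 + b^2 replaces Cauchy-Schwarz.
  It makes the set under the supremum in \<open>regularity_coeff\<close> bounded.\<close>

lemma norm_integral_mult_cnj_le:
  assumes "f \<in> L2 M" "g \<in> L2 M"
    and "(LINT \<omega>|M. (cmod (f \<omega>))\<^sup>2) \<le> 1" "(LINT \<omega>|M. (cmod (g \<omega>))\<^sup>2) \<le> 1"
  shows "cmod (LINT \<omega>|M. f \<omega> * cnj (g \<omega>)) \<le> 1"
proof -
  have f: "integrable M (\<lambda>\<omega>. (cmod (f \<omega>))\<^sup>2)" and g: "integrable M (\<lambda>\<omega>. (cmod (g \<omega>))\<^sup>2)"
    and fm: "f \<in> borel_measurable M" and gm: "g \<in> borel_measurable M"
    using assms by (auto simp: L2_def)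
  have "cmod (LINT \<omega>|M. f \<omega> * cnj (g \<omega>)) \<le> (LINT \<omega>|M. cmod (f \<omega> * cnj (g \<omega>)))"
    by (rule integral_norm_bound)
  also have "\<dots> \<le> (LINT \<omega>|M. ((cmod (f \<omega>))\<^sup>2 + (cmod (g \<omega>))\<^sup>2) / 2)"
  proof (rule integral_mono)
    show "integrable M (\<lambda>\<omega>. cmod (f \<omega> * cnj (g \<omega>)))"
      by (intro integrable_norm integrable_mult_cnj fm gm f g)
    show "integrable M (\<lambda>\<omega>. ((cmod (f \<omega>))\<^sup>2 + (cmod (g \<omega>))\<^sup>2) / 2)" using f g by simp
    fix \<omega> show "cmod (f \<omega> * cnj (g \<omega>)) \<le> ((cmod (f \<omega>))\<^sup>2 + (cmod (g \<omega>))\<^sup>2) / 2"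
      using sum_squares_bound[of "cmod (f \<omega>)" "cmod (g \<omega>)"] by (simp add: norm_mult)
  qed
  also have "\<dots> = ((LINT \<omega>|M. (cmod (f \<omega>))\<^sup>2) + (LINT \<omega>|M. (cmod (g \<omega>))\<^sup>2)) / 2"
    using f g by simp
  also have "\<dots> \<le> 1" using assms(3,4) by simp
  finally show ?thesis .
qed

text \<open>Different indices may give the same function, hence the multiplicities \<open>card\<close> in the proof.\<close>

lemma fun_span_sum:
  fixes f :: "'i \<Rightarrow> 'a \<Rightarrow> complex"
  assumes "finite K" "\<And>k. k \<in> K \<Longrightarrow> f k \<in> S"
  shows "(\<lambda>\<omega>. a * (\<Sum>k\<in>K. f k \<omega>)) \<in> fun_span S"
proof -
  have "a * (\<Sum>k\<in>K. f k \<omega>) = (\<Sum>g\<in>f ` K. (a * of_nat (card {k\<in>K. f k = g})) * g \<omega>)" for \<omega>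
  proof -
    have "(\<Sum>k\<in>K. f k \<omega>) = (\<Sum>g\<in>f ` K. \<Sum>k\<in>{k\<in>K. f k = g}. f k \<omega>)"
      using assms(1) by (rule sum.image_gen)
    also have "\<dots> = (\<Sum>g\<in>f ` K. of_nat (card {k\<in>K. f k = g}) * g \<omega>)"
      by (intro sum.cong refl) auto
    finally show ?thesis by (simp add: sum_distrib_left mult.assoc)
  qed
  then show ?thesis
    unfolding fun_span_def mem_Collect_eq
    using assms by (intro exI[of _ "f ` K"] exI[of _ "\<lambda>g. a * of_nat (card {k\<in>K. f k = g})"]) auto
qed

lemma fun_span_in_L2_closed_span:
  assumes "g \<in> fun_span S" "g \<in> L2 M"
  shows "g \<in> L2_closed_span M S"
proof -
  have "\<exists>h\<in>fun_span S. (LINT \<omega>|M. (cmod (g \<omega> - h \<omega>))\<^sup>2) < \<epsilon>" if "\<epsilon> > 0" for \<epsilon>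
    using that by (intro bexI[OF _ assms(1)]) simp
  then show ?thesis unfolding L2_closed_span_def using assms(2) by blast
qed

lemma regularity_coeff_ge:
  assumes "\<xi> \<in> past M x 0" "\<eta> \<in> future M x (int n)"
    and "(LINT \<omega>|M. (cmod (\<xi> \<omega>))\<^sup>2) \<le> 1" "(LINT \<omega>|M. (cmod (\<eta> \<omega>))\<^sup>2) \<le> 1"
  shows "cmod (LINT \<omega>|M. \<xi> \<omega> * cnj (\<eta> \<omega>)) \<le> regularity_coeff M x n"
  unfolding regularity_coeff_def
proof (rule cSup_upper)
  show "cmod (LINT \<omega>|M. \<xi> \<omega> * cnj (\<eta> \<omega>)) \<in> {cmod (LINT \<omega>|M. \<xi> \<omega> * cnj (\<eta> \<omega>)) | \<xi> \<eta>.
            \<xi> \<in> past M x 0 \<and> \<eta> \<in> future M x (int n) \<and>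
            (LINT \<omega>|M. (cmod (\<xi> \<omega>))\<^sup>2) \<le> 1 \<and> (LINT \<omega>|M. (cmod (\<eta> \<omega>))\<^sup>2) \<le> 1}"
    unfolding mem_Collect_eq by (intro exI[of _ \<xi>] exI[of _ \<eta>] conjI refl assms)
  have L2: "f \<in> L2_closed_span M S \<Longrightarrow> f \<in> L2 M" for f S
    by (simp add: L2_closed_span_def)
  show "bdd_above {cmod (LINT \<omega>|M. \<xi> \<omega> * cnj (\<eta> \<omega>)) | \<xi> \<eta>.
            \<xi> \<in> past M x 0 \<and> \<eta> \<in> future M x (int n) \<and>
            (LINT \<omega>|M. (cmod (\<xi> \<omega>))\<^sup>2) \<le> 1 \<and> (LINT \<omega>|M. (cmod (\<eta> \<omega>))\<^sup>2) \<le> 1}"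
    unfolding past_def future_def
    by (rule bdd_aboveI[of _ 1], elim CollectE exE conjE, hypsubst,
        rule norm_integral_mult_cnj_le, (erule L2 | assumption)+)
qed

lemma sphere_power_int: 
  assumes "z \<in> sphere 0 1"
  shows "z powi (int l - int k) = z ^ l * cnj (z ^ k)"
proof -
  have z: "z \<noteq> 0" "z * cnj z = 1" using assms by (auto simp flip: complex_norm_square)
  then have "inverse z = cnj z" by (simp add: inverse_unique)
  then have "cnj (z ^ k) = inverse (z ^ k)" by (simp flip: power_inverse)
  then show ?thesis using z by (simp add: power_int_diff divide_inverse)
qed

text \<open>The spectral isometry for finite sums of a single coordinate: x(k) is represented by
  z^(-k) in the scalar space L2(w dm), since the correlation of x(k) and x(l) is the integral of w
  z^(l - k). Thus only one diagonal entry of W has to be studied.\<close>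

lemma correlation_sums:
  fixes x :: "int \<Rightarrow> 'a \<Rightarrow> complex^'d" and w :: "complex \<Rightarrow> real" and f g :: "nat \<Rightarrow> int"
  assumes st: "stationary_process M x" and sd: "has_spectral_density M x W"
    and w: "\<And>z. z \<in> sphere 0 1 \<Longrightarrow> W z $ j $ j = complex_of_real (w z)"
    and wint: "integrable circle_measure w"
  shows "(LINT \<omega>|M. (\<Sum>k<N. x (f k) \<omega> $ j) * cnj (\<Sum>l<N. x (g l) \<omega> $ j))
    = (LINT z|circle_measure. complex_of_real (w z) * (\<Sum>k<N. \<Sum>l<N. z powi (g l - f k)))"
proof -
  have xm: "(\<lambda>\<omega>. x k \<omega> $ j) \<in> borel_measurable M" for k
    using st unfolding stationary_process_def by (blast intro: measurable_compose[OF _ vec_nth_measurable])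
  have xi: "integrable M (\<lambda>\<omega>. x k \<omega> $ j * cnj (x l \<omega> $ j))" for k l
    using st xm by (intro integrable_mult_cnj) (auto simp: stationary_process_def)
  have wi: "integrable circle_measure (\<lambda>z. complex_of_real (w z) * z powi m)" for m
  proof (rule Bochner_Integration.integrable_bound[OF wint])
    have wm: "w \<in> borel_measurable circle_measure" using wint by auto
    moreover have "(\<lambda>z. z powi m) \<in> borel_measurable circle_measure"
      unfolding power_int_def by (rule measurable_circle_measure) measurable
    ultimately show "(\<lambda>z. complex_of_real (w z) * z powi m) \<in> borel_measurable circle_measure"
      by measurable
  qed (auto simp: norm_mult norm_power_int)
  have E: "(LINT \<omega>|M. x k \<omega> $ j * cnj (x l \<omega> $ j)) = (LINT z|circle_measure. complex_of_real (w z) * z powi (l - k))" for k l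
  proof -
    have "(LINT \<omega>|M. x k \<omega> $ j * cnj (x l \<omega> $ j)) = correlation M x k l $ j $ j"
      by (simp add: correlation_def)
    also have "\<dots> = fourier_coeff W (k - l) $ j $ j" using sd by (simp add: has_spectral_density_def)
    also have "\<dots> = (LINT z|circle_measure. W z $ j $ j * z powi (l - k))"
      by (simp add: fourier_coeff_def)
    also have "\<dots> = (LINT z|circle_measure. complex_of_real (w z) * z powi (l - k))"
      by (intro Bochner_Integration.integral_cong refl) (simp add: w)
    finally show ?thesis .
  qed
  have "(LINT \<omega>|M. (\<Sum>k<N. x (f k) \<omega> $ j) * cnj (\<Sum>l<N. x (g l) \<omega> $ j))
      = (LINT \<omega>|M. (\<Sum>k<N. \<Sum>l<N. x (f k) \<omega> $ j * cnj (x (g l) \<omega> $ j)))"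
    by (simp only: cnj_sum sum_product)
  also have "\<dots> = (\<Sum>k<N. \<Sum>l<N. LINT \<omega>|M. x (f k) \<omega> $ j * cnj (x (g l) \<omega> $ j))"
    using xi by (simp add: Bochner_Integration.integral_sum)
  also have "\<dots> = (\<Sum>k<N. \<Sum>l<N. LINT z|circle_measure. complex_of_real (w z) * z powi (g l - f k))"
    by (simp add: E)
  also have "\<dots> = (LINT z|circle_measure. (\<Sum>k<N. \<Sum>l<N. complex_of_real (w z) * z powi (g l - f k)))"
    using wi by (simp add: Bochner_Integration.integral_sum)
  also have "\<dots> = (LINT z|circle_measure. complex_of_real (w z) * (\<Sum>k<N. \<Sum>l<N. z powi (g l - f k)))"
    by (simp add: sum_distrib_left)
  finally show ?thesis .
qed

lemma process_sum_in_L2: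
  fixes x :: "int \<Rightarrow> 'a \<Rightarrow> complex^'d" and f :: "nat \<Rightarrow> int"
  assumes st: "stationary_process M x"
  shows "(\<lambda>\<omega>. a * (\<Sum>k<N. x (f k) \<omega> $ j)) \<in> L2 M"
proof -
  have xm: "(\<lambda>\<omega>. x k \<omega> $ j) \<in> borel_measurable M" for k
    using st unfolding stationary_process_def by (blast intro: measurable_compose[OF _ vec_nth_measurable])
  have xi: "integrable M (\<lambda>\<omega>. x k \<omega> $ j * cnj (x l \<omega> $ j))" for k l
    using st xm by (intro integrable_mult_cnj) (auto simp: stationary_process_def)
  have m: "(\<lambda>\<omega>. a * (\<Sum>k<N. x (f k) \<omega> $ j)) \<in> borel_measurable M" using xm by measurable
  have "integrable M (\<lambda>\<omega>. Re ((a * cnj a) * (\<Sum>k<N. \<Sum>l<N. x (f k) \<omega> $ j * cnj (x (f l) \<omega> $ j))))"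
    using xi by (intro integrable_Re integrable_mult_right Bochner_Integration.integrable_sum)
  also have "(\<lambda>\<omega>. Re ((a * cnj a) * (\<Sum>k<N. \<Sum>l<N. x (f k) \<omega> $ j * cnj (x (f l) \<omega> $ j))))
      = (\<lambda>\<omega>. Re ((a * (\<Sum>k<N. x (f k) \<omega> $ j)) * cnj (a * (\<Sum>k<N. x (f k) \<omega> $ j))))"
    by (simp only: sum_product[symmetric] cnj_sum[symmetric] complex_cnj_mult mult_ac)
  also have "\<dots> = (\<lambda>\<omega>. (cmod (a * (\<Sum>k<N. x (f k) \<omega> $ j)))\<^sup>2)"
    by (simp only: complex_norm_square[symmetric] Re_complex_of_real)
  finally show ?thesis using m by (simp add: L2_def)
qed

text \<open>The test pair is a block of N variables just before time 0 and a block of N variables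
  from time n on, in one coordinate. T bounds both squared norms, and a correlation of at least T /
  2 keeps every regularity coefficient above 1/2.\<close>

lemma not_completely_regularI:
  fixes x :: "int \<Rightarrow> 'a \<Rightarrow> complex^'d" and w :: "complex \<Rightarrow> real"
  assumes st: "stationary_process M x" and sd: "has_spectral_density M x W"
    and w: "\<And>z. z \<in> sphere 0 1 \<Longrightarrow> W z $ j $ j = complex_of_real (w z)"
    and wint: "integrable circle_measure w"
    and test: "\<And>n. \<exists>N T. 0 < T \<and> (LINT z|circle_measure. w z * (cmod (\<Sum>k<N. z ^ k))\<^sup>2) \<le> T \<and>
      T / 2 \<le> cmod (LINT z|circle_measure. complex_of_real (w z) * (z ^ (n+1) * (\<Sum>k<N. z ^ k)\<^sup>2))"
  shows "\<not> completely_regular M x"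
proof
  assume "completely_regular M x"
  then have lim: "regularity_coeff M x \<longlonglongrightarrow> 0" by (simp add: completely_regular_def)
  have "1/2 \<le> regularity_coeff M x n" for n
  proof -
    obtain N T where T: "0 < T" "(LINT z|circle_measure. w z * (cmod (\<Sum>k<N. z ^ k))\<^sup>2) \<le> T"
      "T / 2 \<le> cmod (LINT z|circle_measure. complex_of_real (w z) * (z ^ (n+1) * (\<Sum>k<N. z ^ k)\<^sup>2))"
      using test by blast
    define a where "a = complex_of_real (1 / sqrt T)"
    have a2: "(cmod a)\<^sup>2 = 1 / T" using T by (simp add: a_def norm_divide power_divide)
    have aa: "a * cnj a = complex_of_real (1 / T)" using a2 by (simp flip: complex_norm_square)
    \<comment> \<open>The past block is numbered backwards from -1 and the future block forwards
      from n, so g l - f k = n + 1 + k + l and the double sum factors as z^(n+1) times the square of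
      the geometric sum.\<close>
    define f g where "f = (\<lambda>k::nat. - 1 - int k)" and "g = (\<lambda>l::nat. int n + int l)"
    define \<xi> where "\<xi> = (\<lambda>\<omega>. a * (\<Sum>k<N. x (f k) \<omega> $ j))"
    define \<eta> where "\<eta> = (\<lambda>\<omega>. a * (\<Sum>k<N. x (g k) \<omega> $ j))"
    have fS: "(\<lambda>\<omega>. x (f k) \<omega> $ j) \<in> {(\<lambda>\<omega>. x k \<omega> $ j) | j k. k < 0}" for k
      unfolding mem_Collect_eq by (intro exI[of _ j] exI[of _ "f k"]) (simp add: f_def)
    have gS: "(\<lambda>\<omega>. x (g k) \<omega> $ j) \<in> {(\<lambda>\<omega>. x k \<omega> $ j) | j k. int n \<le> k}" for k
      unfolding mem_Collect_eq by (intro exI[of _ j] exI[of _ "g k"]) (simp add: g_def)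
    have "\<xi> \<in> past M x 0" unfolding past_def \<xi>_def
      by (intro fun_span_in_L2_closed_span process_sum_in_L2 st fun_span_sum fS) simp
    moreover have "\<eta> \<in> future M x (int n)" unfolding future_def \<eta>_def
      by (intro fun_span_in_L2_closed_span process_sum_in_L2 st fun_span_sum gS) simp
    moreover have norm_le: "(LINT \<omega>|M. (cmod (a * (\<Sum>k<N. x (h k) \<omega> $ j)))\<^sup>2) \<le> 1"
      \<comment> \<open>The two numberings run in opposite directions, but the double sum over
        differences is symmetric in k and l, so both norms equal the same integral.\<close>
      if h: "(\<forall>k l. h l - h k = int l - int k) \<or> (\<forall>k l. h l - h k = int k - int l)" for h
    proof -
      have "complex_of_real (LINT \<omega>|M. (cmod (a * (\<Sum>k<N. x (h k) \<omega> $ j)))\<^sup>2)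
          = (LINT \<omega>|M. (a * cnj a) * ((\<Sum>k<N. x (h k) \<omega> $ j) * cnj (\<Sum>k<N. x (h k) \<omega> $ j)))"
        unfolding integral_complex_of_real[symmetric] complex_norm_square
        by (intro Bochner_Integration.integral_cong refl) (simp add: algebra_simps)
      also have "\<dots> = complex_of_real (1/T) * (LINT z|circle_measure. complex_of_real (w z) * (\<Sum>k<N. \<Sum>l<N. z powi (h l - h k)))"
        unfolding aa integral_mult_right_zero by (subst correlation_sums[OF st sd w wint]) (assumption | rule refl)+
      also have "(LINT z|circle_measure. complex_of_real (w z) * (\<Sum>k<N. \<Sum>l<N. z powi (h l - h k)))
          = (LINT z|circle_measure. complex_of_real (w z * (cmod (\<Sum>k<N. z ^ k))\<^sup>2))"
      proof (intro Bochner_Integration.integral_cong refl)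
        fix z assume "z \<in> space circle_measure"
        then have z: "z \<in> sphere 0 1" by simp
        have "(\<Sum>k<N. \<Sum>l<N. z powi (int l - int k)) = (\<Sum>l<N. z ^ l) * cnj (\<Sum>l<N. z ^ l)"
          unfolding sphere_power_int[OF z] by (subst sum.swap) (simp add: sum_product)
        moreover have "(\<Sum>k<N. \<Sum>l<N. z powi (int k - int l)) = (\<Sum>l<N. z ^ l) * cnj (\<Sum>l<N. z ^ l)"
          unfolding sphere_power_int[OF z] by (simp add: sum_product)
        ultimately have "(\<Sum>k<N. \<Sum>l<N. z powi (h l - h k)) = (\<Sum>l<N. z ^ l) * cnj (\<Sum>l<N. z ^ l)"
          using h by auto
        then show "complex_of_real (w z) * (\<Sum>k<N. \<Sum>l<N. z powi (h l - h k)) = complex_of_real (w z * (cmod (\<Sum>k<N. z ^ k))\<^sup>2)"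
          by (simp only: of_real_mult complex_norm_square)
      qed
      also have "complex_of_real (1/T) * \<dots> = complex_of_real ((1/T) * (LINT z|circle_measure. w z * (cmod (\<Sum>k<N. z ^ k))\<^sup>2))"
        by (subst integral_complex_of_real) (simp only: of_real_mult)
      finally have "(LINT \<omega>|M. (cmod (a * (\<Sum>k<N. x (h k) \<omega> $ j)))\<^sup>2)
          = (1/T) * (LINT z|circle_measure. w z * (cmod (\<Sum>k<N. z ^ k))\<^sup>2)"
        by (simp only: of_real_eq_iff)
      also have "\<dots> \<le> (1/T) * T" by (intro mult_left_mono T(2)) (use T(1) in auto)
      also have "\<dots> = 1" using T(1) by simp
      finally show ?thesis .
    qed
    have "(LINT \<omega>|M. (cmod (\<xi> \<omega>))\<^sup>2) \<le> 1" "(LINT \<omega>|M. (cmod (\<eta> \<omega>))\<^sup>2) \<le> 1"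
      unfolding \<xi>_def \<eta>_def
      by (rule norm_le, rule disjI2, simp add: f_def) (rule norm_le, rule disjI1, simp add: g_def)
    ultimately have le: "cmod (LINT \<omega>|M. \<xi> \<omega> * cnj (\<eta> \<omega>)) \<le> regularity_coeff M x n"
      by (intro regularity_coeff_ge)
    have "(LINT \<omega>|M. \<xi> \<omega> * cnj (\<eta> \<omega>))
        = (LINT \<omega>|M. (a * cnj a) * ((\<Sum>k<N. x (f k) \<omega> $ j) * cnj (\<Sum>k<N. x (g k) \<omega> $ j)))"
      unfolding \<xi>_def \<eta>_def
      by (intro Bochner_Integration.integral_cong refl) (simp add: algebra_simps)
    also have "\<dots> = complex_of_real (1/T) * (LINT z|circle_measure. complex_of_real (w z) * (\<Sum>k<N. \<Sum>l<N. z powi (g l - f k)))"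
      unfolding aa integral_mult_right_zero by (subst correlation_sums[OF st sd w wint]) (assumption | rule refl)+
    also have "(LINT z|circle_measure. complex_of_real (w z) * (\<Sum>k<N. \<Sum>l<N. z powi (g l - f k)))
        = (LINT z|circle_measure. complex_of_real (w z) * (z ^ (n+1) * (\<Sum>k<N. z ^ k)\<^sup>2))"
    proof (intro Bochner_Integration.integral_cong refl arg_cong2[where f="(*)"])
      fix z :: complex
      have e: "g l - f k = int (n + 1 + k + l)" for k l by (simp add: f_def g_def)
      have "(\<Sum>k<N. \<Sum>l<N. z powi (g l - f k)) = (\<Sum>k<N. \<Sum>l<N. z ^ (n + 1) * (z ^ k * z ^ l))"
        unfolding e power_int_of_nat by (intro sum.cong refl) (simp add: power_add)
      then show "(\<Sum>k<N. \<Sum>l<N. z powi (g l - f k)) = z ^ (n+1) * (\<Sum>k<N. z ^ k)\<^sup>2"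
        unfolding power2_eq_square sum_product by (simp only: sum_distrib_left)
    qed
    finally have prod: "(LINT \<omega>|M. \<xi> \<omega> * cnj (\<eta> \<omega>)) = complex_of_real (1/T) *
          (LINT z|circle_measure. complex_of_real (w z) * (z ^ (n+1) * (\<Sum>k<N. z ^ k)\<^sup>2))" .
    have scale: "cmod (complex_of_real (1/T) * Z) = (1/T) * cmod Z" for Z
      using T(1) by (simp add: norm_mult norm_divide)
    have "T/2 \<le> cmod (LINT z|circle_measure. complex_of_real (w z) * (z ^ (n+1) * (\<Sum>k<N. z ^ k)\<^sup>2))"
      by (rule T(3))
    then have "(1/T) * (T/2) \<le> cmod (LINT \<omega>|M. \<xi> \<omega> * cnj (\<eta> \<omega>))"
      unfolding prod scale using T(1) by (intro mult_left_mono) auto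
    moreover have "(1/T) * (T/2) = 1/2" using T(1) by simp
    ultimately show ?thesis using le by linarith
  qed
  then have "1/2 \<le> (0::real)" by (intro LIMSEQ_le_const[OF lim]) auto
  then show False by simp
qed

section \<open>Spectral decompositions and processes with a given density\<close>

lemma chi_sum_axis: "(\<chi> i. f i) = (\<Sum>i\<in>UNIV. axis i (f i :: 'b::comm_monoid_add))"
  by (simp add: vec_eq_iff axis_def)

lemma bounded_linear_axis: "bounded_linear (axis i :: 'b::euclidean_space \<Rightarrow> 'b^'n)"
  unfolding linear_conv_bounded_linear[symmetric]
  by (rule linearI) (auto simp: vec_eq_iff axis_def)

lemma integrable_chi:
  fixes f :: "'n::finite \<Rightarrow> 'a \<Rightarrow> 'b::euclidean_space"
  assumes "\<And>i. integrable M (f i)"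
  shows "integrable M (\<lambda>\<omega>. \<chi> i. f i \<omega>)"
  unfolding chi_sum_axis
  by (intro Bochner_Integration.integrable_sum integrable_bounded_linear[OF bounded_linear_axis] assms)

lemma measurable_chi:
  fixes f :: "'n::finite \<Rightarrow> 'a \<Rightarrow> 'b::euclidean_space"
  assumes "\<And>i. f i \<in> borel_measurable M"
  shows "(\<lambda>\<omega>. \<chi> i. f i \<omega>) \<in> borel_measurable M"
  unfolding chi_sum_axis
  by (intro borel_measurable_sum measurable_compose[OF assms]
      borel_measurable_continuous_onI linear_continuous_on bounded_linear_axis)

section \<open>Quadratic forms of unitarily diagonalized matrices\<close>

lemma adjoint_matrix_mult: "adjoint_matrix (A ** B) = adjoint_matrix B ** adjoint_matrix A"
  by (simp add: vec_eq_iff adjoint_matrix_def matrix_matrix_mult_def mult.commute)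

lemma adjoint_adjoint [simp]: "adjoint_matrix (adjoint_matrix A) = A"
  by (simp add: vec_eq_iff adjoint_matrix_def)

lemma adjoint_real_diag [simp]: "adjoint_matrix (real_diag d) = real_diag d"
  by (simp add: vec_eq_iff adjoint_matrix_def real_diag_def)

lemma cinner_vec_matrix: "cinner_vec (A *v u) v = cinner_vec u (adjoint_matrix A *v v)"
proof -
  have "cinner_vec (A *v u) v = (\<Sum>i\<in>UNIV. \<Sum>j\<in>UNIV. A $ i $ j * u $ j * cnj (v $ i))"
    by (simp add: cinner_vec_def matrix_vector_mult_def sum_distrib_right)
  also have "\<dots> = (\<Sum>j\<in>UNIV. \<Sum>i\<in>UNIV. A $ i $ j * u $ j * cnj (v $ i))"
    by (rule sum.swap)
  also have "\<dots> = cinner_vec u (adjoint_matrix A *v v)"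
    by (simp add: cinner_vec_def matrix_vector_mult_def adjoint_matrix_def sum_distrib_left mult_ac)
  finally show ?thesis .
qed

lemma cinner_vec_spectral:
  "Re (cinner_vec ((U ** real_diag d ** adjoint_matrix U) *v v) v)
    = (\<Sum>i\<in>UNIV. d i * (cmod ((adjoint_matrix U *v v) $ i))\<^sup>2)"
proof -
  define u where "u = adjoint_matrix U *v v"
  have e: "(real_diag d *v u) $ i * cnj (u $ i) = complex_of_real (d i * (cmod (u $ i))\<^sup>2)" for i
  proof -
    have "(real_diag d *v u) $ i = complex_of_real (d i) * u $ i"
      by (simp add: matrix_vector_mult_def real_diag_def if_distrib[of "\<lambda>y. y * _"] cong: if_cong)
    then show ?thesis by (simp only: of_real_mult complex_norm_square mult.assoc)
  qed
  have "(U ** real_diag d ** adjoint_matrix U) *v v = U *v (real_diag d *v u)"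
    by (simp add: u_def matrix_vector_mul_assoc matrix_mul_assoc)
  then have "cinner_vec ((U ** real_diag d ** adjoint_matrix U) *v v) v = cinner_vec (real_diag d *v u) u"
    by (simp add: cinner_vec_matrix u_def)
  also have "\<dots> = (\<Sum>i\<in>UNIV. complex_of_real (d i * (cmod (u $ i))\<^sup>2))"
    unfolding cinner_vec_def e ..
  finally show ?thesis unfolding u_def by (simp only: of_real_sum[symmetric] Re_complex_of_real)
qed

lemma hermitian_spectral: "hermitian (U ** real_diag d ** adjoint_matrix U)"
  by (simp add: hermitian_def adjoint_matrix_mult matrix_mul_assoc)

lemma nonneg_spectral:
  assumes "\<And>i. 0 \<le> d i"
  shows "nonneg_matrix (U ** real_diag d ** adjoint_matrix U)"
  unfolding nonneg_matrix_def cinner_vec_spectral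
  using assms by (auto intro!: sum_nonneg hermitian_spectral)

text \<open>Since U is unitary, its adjoint is injective, so a nonzero vector has a nonzero
  coordinate in the eigenbasis and one summand of the diagonal form is positive.\<close>

lemma posdef_spectral:
  assumes U: "unitary_matrix U" and d: "\<And>i. 0 < d i"
  shows "posdef_matrix (U ** real_diag d ** adjoint_matrix U)"
  unfolding posdef_matrix_def cinner_vec_spectral
proof (intro conjI allI impI hermitian_spectral)
  fix v :: "complex^'a" assume v: "v \<noteq> 0"
  have "U *v (adjoint_matrix U *v v) = v"
    using U by (simp add: matrix_vector_mul_assoc unitary_matrix_def)
  then have "adjoint_matrix U *v v \<noteq> 0" using v by (metis matrix_vector_mult_0_right)
  then obtain i where "(adjoint_matrix U *v v) $ i \<noteq> 0" by (auto simp: vec_eq_iff)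
  then show "0 < (\<Sum>i\<in>UNIV. d i * (cmod ((adjoint_matrix U *v v) $ i))\<^sup>2)"
    using d by (intro sum_pos2[of _ i]) (auto intro!: mult_nonneg_nonneg less_imp_le[OF d])
qed

section \<open>Two by two matrices with a rotated eigenbasis\<close>

definition rot :: "real \<Rightarrow> complex^2^2" where
  "rot g = (\<chi> i j. complex_of_real (if i = j then sqrt (1 - g\<^sup>2) else if i = 1 then - g else g))"

text \<open>Logarithm and inverse act on a and b alone, so \<open>weight\<close>, its logarithm and
  its inverse all have this form. The rotation is parametrized by its sine because the sine is the
  factor that tempers the off-diagonal entry (a - b) g sqrt (1 - g^2).\<close>

definition rot_diag :: "real \<Rightarrow> real \<Rightarrow> real \<Rightarrow> complex^2^2" where
  "rot_diag a b g = rot g ** real_diag (\<lambda>i. if i = 1 then a else b) ** adjoint_matrix (rot g)"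

lemma unitary_rot:
  assumes "\<bar>g\<bar> \<le> 1"
  shows "unitary_matrix (rot g)"
proof -
  have "g\<^sup>2 \<le> 1" using assms by (simp add: abs_square_le_1)
  then have "complex_of_real (sqrt (1 - g\<^sup>2)) * complex_of_real (sqrt (1 - g\<^sup>2)) = 1 - (complex_of_real g)\<^sup>2"
    by (simp flip: of_real_mult)
  then show ?thesis
    by (simp add: unitary_matrix_def rot_def adjoint_matrix_def matrix_matrix_mult_def vec_eq_iff
        forall_2 sum_2 mat_def power2_eq_square mult.commute)
qed

lemma rot_diag_entries:
  assumes "\<bar>g\<bar> \<le> 1"
  shows "rot_diag a b g = (\<chi> i j. complex_of_real
    (if i = j then if i = 1 then a * (1 - g\<^sup>2) + b * g\<^sup>2 else a * g\<^sup>2 + b * (1 - g\<^sup>2)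
     else (a - b) * g * sqrt (1 - g\<^sup>2)))"
proof -
  have "g\<^sup>2 \<le> 1" using assms by (simp add: abs_square_le_1)
  then have e: "complex_of_real (sqrt (1 - g\<^sup>2)) * complex_of_real (sqrt (1 - g\<^sup>2)) = 1 - (complex_of_real g)\<^sup>2"
    by (simp flip: of_real_mult)
  then have e': "complex_of_real (sqrt (1 - g\<^sup>2)) * (x * complex_of_real (sqrt (1 - g\<^sup>2))) = x * (1 - (complex_of_real g)\<^sup>2)" for x
    by (metis mult.left_commute)
  show ?thesis
    by (simp add: rot_diag_def rot_def real_diag_def adjoint_matrix_def matrix_matrix_mult_def vec_eq_iff
        forall_2 sum_2)
      (simp add: e e' mult.assoc, simp add: power2_eq_square algebra_simps)
qed

lemma rot_diag_log:
  assumes "\<bar>g\<bar> \<le> 1"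
  shows "matrix_log (rot_diag a b g) = rot_diag (ln a) (ln b) g"
proof (rule matrix_log_eqI)
  have "real_diag (ln \<circ> (\<lambda>i::2. if i = 1 then a else b)) = real_diag (\<lambda>i::2. if i = 1 then ln a else ln b)"
    by (intro arg_cong[where f=real_diag] ext) auto
  then show "hermitian_calc ln (rot_diag a b g) (rot_diag (ln a) (ln b) g)"
    unfolding hermitian_calc_def rot_diag_def
    by (intro exI[of _ "rot g"] exI[of _ "\<lambda>i. if i = 1 then a else b"] conjI unitary_rot assms refl) simp
qed

lemma matrix_inv_eqI:
  fixes A B :: "'a::field^'n^'n"
  assumes "A ** B = mat 1"
  shows "matrix_inv A = B"
proof -
  have BA: "B ** A = mat 1" using assms matrix_left_right_inverse by blast
  have "A ** matrix_inv A = mat 1 \<and> matrix_inv A ** A = mat 1"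
    unfolding matrix_inv_def by (rule someI[of _ B]) (use assms BA in auto)
  then show ?thesis using BA by (metis matrix_mul_assoc matrix_mul_lid matrix_mul_rid)
qed

lemma rot_diag_inv:
  assumes g: "\<bar>g\<bar> \<le> 1" and "a \<noteq> 0" "b \<noteq> 0"
  shows "matrix_inv (rot_diag a b g) = rot_diag (1/a) (1/b) g"
proof (rule matrix_inv_eqI)
  let ?U = "rot g" and ?d = "\<lambda>i::2. if i = 1 then a else b" and ?e = "\<lambda>i::2. if i = 1 then 1/a else 1/b"
  have U: "adjoint_matrix ?U ** ?U = mat 1" "?U ** adjoint_matrix ?U = mat 1"
    using unitary_rot[OF g] by (auto simp: unitary_matrix_def)
  have de: "real_diag ?d ** real_diag ?e = mat 1"
    using assms by (simp add: real_diag_def matrix_matrix_mult_def vec_eq_iff forall_2 sum_2 mat_def)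
  have "rot_diag a b g ** rot_diag (1/a) (1/b) g
      = ?U ** (real_diag ?d ** (adjoint_matrix ?U ** ?U) ** real_diag ?e) ** adjoint_matrix ?U"
    unfolding rot_diag_def by (simp only: matrix_mul_assoc)
  then show "rot_diag a b g ** rot_diag (1/a) (1/b) g = mat 1"
    by (simp add: U de)
qed

text \<open>An interval of length 4 pi serves as two disjoint copies of the circle of probability
  1/2 each; by periodicity of \<open>cis\<close> the second half is a translate of the
  first.\<close>

lemma integral_uniform_double_circle:
  fixes F G :: "complex \<Rightarrow> 'b::{banach, second_countable_topology}"
  assumes F: "integrable circle_measure F" and G: "integrable circle_measure G"
  shows "integrable (uniform_measure lborel {0..<4*pi}) (\<lambda>t. if t < 2*pi then F (cis t) else G (cis t))"
    and "(LINT t|uniform_measure lborel {0..<4*pi}. (if t < 2*pi then F (cis t) else G (cis t)))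
      = ((LINT z|circle_measure. F z) + (LINT z|circle_measure. G z)) /\<^sub>R 2"
proof -
  have [measurable]: "F \<in> borel_measurable circle_measure" "G \<in> borel_measurable circle_measure"
    using F G by auto
  have m: "(\<lambda>t. F (cis t)) \<in> borel_measurable lborel" "(\<lambda>t. G (cis t)) \<in> borel_measurable lborel"
    by measurable
  have [measurable]: "(\<lambda>t. if t < 2*pi then F (cis t) else G (cis t)) \<in> borel_measurable lborel"
    using m by measurable
  define f where "f = (\<lambda>t. indicator {0..<2*pi} t *\<^sub>R F (cis t))"
  define g where "g = (\<lambda>t. indicator {0..<2*pi} t *\<^sub>R G (cis t))"
  have f: "integrable lborel f" and g: "integrable lborel g"
    using integral_circle_measure(2)[of F] integral_circle_measure(2)[of G] F G
    by (auto simp: f_def g_def set_integrable_def)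
  have g': "integrable lborel (\<lambda>t. g (- 2*pi + 1 * t))"
    by (rule lborel_integrable_real_affine[OF g]) simp
  have eq: "(indicator {0..<4*pi} t / (4*pi)) *\<^sub>R (if t < 2*pi then F (cis t) else G (cis t))
      = (1/(4*pi)) *\<^sub>R (f t + g (- 2*pi + 1 * t))" for t
  proof -
    have "cis (- 2*pi + 1 * t) = cis t" using cis_diff_2pi[of t 1] by (simp add: algebra_simps)
    then show ?thesis by (auto simp: f_def g_def indicator_def)
  qed
  show "integrable (uniform_measure lborel {0..<4*pi}) (\<lambda>t. if t < 2*pi then F (cis t) else G (cis t))"
    by (subst uniform_measure_interval, simp, subst integrable_density)
      (simp_all only: eq, auto intro!: f g'[simplified] Bochner_Integration.integrable_add integrable_scaleR_right)
  have "(LINT t|uniform_measure lborel {0..<4*pi}. (if t < 2*pi then F (cis t) else G (cis t)))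
      = (LINT t|lborel. (indicator {0..<4*pi} t / (4*pi)) *\<^sub>R (if t < 2*pi then F (cis t) else G (cis t)))"
    by (subst uniform_measure_interval, simp, subst integral_density) auto
  also have "\<dots> = (1/(4*pi)) *\<^sub>R ((LINT t|lborel. f t) + (LINT t|lborel. g (- 2*pi + 1 * t)))"
    unfolding eq integral_scaleR_right using f g' by (subst Bochner_Integration.integral_add) auto
  also have "(LINT t|lborel. g (- 2*pi + 1 * t)) = (LINT t|lborel. g t)"
    using lborel_integral_real_affine[of 1 g "- 2*pi"] by simp
  also have "(LINT t|lborel. f t) = (2*pi) *\<^sub>R (LINT z|circle_measure. F z)"
    by (subst integral_circle_measure(1)) (auto simp: f_def set_lebesgue_integral_def)
  also have "(LINT t|lborel. g t) = (2*pi) *\<^sub>R (LINT z|circle_measure. G z)"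
    by (subst integral_circle_measure(1)) (auto simp: g_def set_lebesgue_integral_def)
  finally show "(LINT t|uniform_measure lborel {0..<4*pi}. (if t < 2*pi then F (cis t) else G (cis t)))
      = ((LINT z|circle_measure. F z) + (LINT z|circle_measure. G z)) /\<^sub>R 2"
    by (simp add: scaleR_add_right[symmetric] del: scaleR_add_right)
qed

text \<open>On \<open>[0, 4 * pi)\<close> the half in which \<open>t\<close> lies selects a column of \<open>V\<close>, independently of \<open>cis t\<close>.\<close>

lemma exists_process_with_density:
  fixes V :: "complex \<Rightarrow> complex^2^2"
  assumes Vm: "\<And>i k. (\<lambda>z. V z $ i $ k) \<in> borel_measurable circle_measure"
    and Vi: "\<And>i k. integrable circle_measure (\<lambda>z. (cmod (V z $ i $ k))\<^sup>2)"
    and W: "\<And>z. z \<in> sphere 0 1 \<Longrightarrow> W z = V z ** adjoint_matrix (V z)"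
  shows "\<exists>(M :: real measure) (x :: int \<Rightarrow> real \<Rightarrow> complex^2).
    stationary_process M x \<and> has_spectral_density M x W"
proof -
  let ?M = "uniform_measure lborel {0..<4*pi}"
  define col where "col = (\<lambda>t i. if t < 2*pi then V (cis t) $ i $ 1 else V (cis t) $ i $ 2)"
  \<comment> \<open>The factor sqrt 2 compensates for each half having probability 1/2. The exponent
    -n matches the convention of \<open>fourier_coeff\<close>: products carry z^(k - n) = z^(-(n -
    k)).\<close>
  define x :: "int \<Rightarrow> real \<Rightarrow> complex^2" where
    "x = (\<lambda>n t. \<chi> i. complex_of_real (sqrt 2) * (cis t powi (- n) * col t i))"
  have prod_i: "integrable circle_measure (\<lambda>z. 2 * (z powi m * (V z $ i $ k * cnj (V z $ j $ k))))" for i j k m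
  proof (rule integrable_mult_right, rule Bochner_Integration.integrable_bound)
    show "integrable circle_measure (\<lambda>z. V z $ i $ k * cnj (V z $ j $ k))"
      by (intro integrable_mult_cnj Vm Vi)
    have "(\<lambda>z. z powi m) \<in> borel_measurable circle_measure"
      unfolding power_int_def by (rule measurable_circle_measure) measurable
    then show "(\<lambda>z. z powi m * (V z $ i $ k * cnj (V z $ j $ k))) \<in> borel_measurable circle_measure"
      using Vm by measurable
  qed (auto simp: norm_mult norm_power_int)
  have prod: "x n t $ i * cnj (x k t $ j) = (if t < 2*pi
      then 2 * (cis t powi (k - n) * (V (cis t) $ i $ 1 * cnj (V (cis t) $ j $ 1)))
      else 2 * (cis t powi (k - n) * (V (cis t) $ i $ 2 * cnj (V (cis t) $ j $ 2))))" for n k t i j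
  proof -
    have "cis t powi (- n) * cnj (cis t powi (- k)) = cis t powi (k - n)"
      by (simp add: cis_power_int cis_cnj cis_mult algebra_simps)
    moreover have "complex_of_real (sqrt 2) * complex_of_real (sqrt 2) = 2"
      by (simp flip: of_real_mult)
    moreover have "x n t $ i * cnj (x k t $ j) = (complex_of_real (sqrt 2) * complex_of_real (sqrt 2)) *
        ((cis t powi (- n) * cnj (cis t powi (- k))) * (col t i * cnj (col t j)))"
      by (simp only: x_def vec_lambda_beta complex_cnj_mult complex_cnj_complex_of_real mult_ac)
    ultimately show ?thesis by (simp add: col_def)
  qed
  have corr: "correlation ?M x n k = fourier_coeff W (n - k)" for n k
  proof -
    have "correlation ?M x n k $ i $ j = fourier_coeff W (n - k) $ i $ j" for i j
    proof -
      have "correlation ?M x n k $ i $ j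
          = ((LINT z|circle_measure. 2 * (z powi (k - n) * (V z $ i $ 1 * cnj (V z $ j $ 1))))
            + (LINT z|circle_measure. 2 * (z powi (k - n) * (V z $ i $ 2 * cnj (V z $ j $ 2))))) /\<^sub>R 2"
        unfolding correlation_def vec_lambda_beta prod
        by (rule integral_uniform_double_circle(2)[OF prod_i prod_i])
      also have "\<dots> = (LINT z|circle_measure. 2 * (z powi (k - n) * (V z $ i $ 1 * cnj (V z $ j $ 1)))
            + 2 * (z powi (k - n) * (V z $ i $ 2 * cnj (V z $ j $ 2)))) /\<^sub>R 2"
        using prod_i by simp
      also have "\<dots> = (LINT z|circle_measure. (2 * (z powi (k - n) * (V z $ i $ 1 * cnj (V z $ j $ 1)))
            + 2 * (z powi (k - n) * (V z $ i $ 2 * cnj (V z $ j $ 2)))) /\<^sub>R 2)"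
        by (rule integral_scaleR_right[symmetric])
      also have "\<dots> = (LINT z|circle_measure. W z $ i $ j * z powi (- (n - k)))"
        by (intro Bochner_Integration.integral_cong refl)
          (simp add: W matrix_matrix_mult_def sum_2 adjoint_matrix_def scaleR_conv_of_real algebra_simps)
      finally show ?thesis by (simp add: fourier_coeff_def)
    qed
    then show ?thesis by (simp add: vec_eq_iff)
  qed
  have "stationary_process ?M x"
    unfolding stationary_process_def
  proof (intro conjI allI impI)
    show "prob_space ?M" by (rule prob_space_uniform_measure) auto
    fix n
    have "(\<lambda>t. x n t $ i) \<in> borel_measurable ?M" for i
    proof -
      have V': "(\<lambda>t. V (cis t) $ i $ k) \<in> borel_measurable lborel" for k
        using measurable_compose[OF cis_measurable_sphere, of "\<lambda>z. V z $ i $ k" borel] Vm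
        by (simp add: measurable_cong_sets[OF sets_circle_measure refl])
      have c: "(\<lambda>t. cis t powi (- n)) \<in> borel_measurable lborel"
        unfolding power_int_def by measurable
      have "(\<lambda>t. x n t $ i) \<in> borel_measurable lborel"
        unfolding x_def vec_lambda_beta col_def using V' c by measurable
      then show ?thesis by (simp add: measurable_cong_sets[OF sets_uniform_measure refl])
    qed
    from measurable_chi[of "\<lambda>i t. x n t $ i", OF this] show "x n \<in> borel_measurable ?M" by simp
    fix j
    have "integrable ?M (\<lambda>t. x n t $ j * cnj (x n t $ j))"
      unfolding prod by (rule integral_uniform_double_circle(1)[OF prod_i prod_i])
    then have "integrable ?M (\<lambda>t. Re (x n t $ j * cnj (x n t $ j)))" by (rule integrable_Re)
    then show "integrable ?M (\<lambda>\<omega>. (cmod (x n \<omega> $ j))\<^sup>2)"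
      by (simp only: complex_norm_square[symmetric] Re_complex_of_real)
  qed (simp add: corr)
  then show ?thesis using corr unfolding has_spectral_density_def by blast
qed

section \<open>The weight\<close>

text \<open>Tents of height 1 and half-width 4 around the points 4^k; the form with
  \<open>infdist\<close> makes continuity immediate. Starting at k = 2 makes the function vanish at
  1 (a tent around 4 would not), as the value at z = 1 requires.\<close>

definition bump :: "real \<Rightarrow> real" where
  "bump x = max 0 (1 - infdist x ((\<lambda>k. 4 ^ k) ` {2::nat..}) / 4)"

lemma continuous_on_bump [continuous_intros]:
  "continuous_on A f \<Longrightarrow> continuous_on A (\<lambda>x. bump (f x))"
  unfolding bump_def by (intro continuous_intros) auto

lemma bump_bounds: "0 \<le> bump x" "bump x \<le> 1"
  using infdist_nonneg[of x "(\<lambda>k. 4 ^ k) ` {2::nat..}"] by (auto simp: bump_def)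

lemma bump_eq_0:
  assumes "\<And>k. 2 \<le> k \<Longrightarrow> 4 \<le> \<bar>x - 4 ^ k\<bar>"
  shows "bump x = 0"
proof -
  have "4 \<le> infdist x ((\<lambda>k. 4 ^ k) ` {2::nat..})"
    unfolding infdist_def
    using assms by (auto intro!: cINF_greatest simp: dist_real_def)
  then show ?thesis by (simp add: bump_def)
qed

lemma bump_ge_half:
  assumes "2 \<le> k" "\<bar>x - 4 ^ k\<bar> \<le> 2"
  shows "1/2 \<le> bump x"
proof -
  have "infdist x ((\<lambda>k. 4 ^ k) ` {2::nat..}) \<le> dist x (4 ^ k)"
    using assms by (intro infdist_le) auto
  then show ?thesis using assms by (simp add: bump_def dist_real_def)
qed

text \<open>The exponent makes x * (x^(-1/4))^2 = sqrt x unbounded while ln x * x^(-1/4) still tends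
  to 0.\<close>

definition tilt :: "real \<Rightarrow> real" where
  "tilt x = bump x * x powr (- 1/4)"

lemma tilt_bounds:
  assumes "1 \<le> x"
  shows "0 \<le> tilt x" "tilt x \<le> x powr (- 1/4)" "tilt x \<le> 1"
proof -
  show "0 \<le> tilt x" using bump_bounds by (simp add: tilt_def)
  show *: "tilt x \<le> x powr (- 1/4)"
    unfolding tilt_def using bump_bounds by (intro mult_left_le_one_le) auto
  have "x powr (- 1/4) \<le> x powr 0" using assms by (intro powr_mono) auto
  with * assms show "tilt x \<le> 1" by simp
qed

lemma tilt_measurable [measurable]: "tilt \<in> borel_measurable borel"
proof -
  have [measurable]: "bump \<in> borel_measurable borel"
    by (intro borel_measurable_continuous_onI continuous_intros)
  show ?thesis unfolding tilt_def by measurable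
qed

lemma tilt_1: "tilt 1 = 0"
proof -
  have "bump 1 = 0"
  proof (rule bump_eq_0)
    fix k :: nat assume "2 \<le> k"
    then have "(4::real) ^ 2 \<le> 4 ^ k" by (intro power_increasing) auto
    then show "4 \<le> \<bar>1 - (4::real) ^ k\<bar>" by simp
  qed
  then show ?thesis by (simp add: tilt_def)
qed

lemma continuous_on_tilt: "continuous_on {1..} tilt"
  unfolding tilt_def by (intro continuous_intros) auto

text \<open>As z -> 1 the height tends to infinity, so the limit there is that of F at infinity. The
  value at z = 1 itself is F 1, because \<open>log_height 1 = 1\<close> by convention; hence the
  assumption F 1 = 0.\<close>

lemma continuous_on_comp_log_height:
  fixes F :: "real \<Rightarrow> real"
  assumes cont: "continuous_on {1..} F" and F1: "F 1 = 0" and lim: "(F \<longlongrightarrow> 0) at_top"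
  shows "continuous_on (sphere 0 1) (\<lambda>z. F (log_height z))"
  unfolding continuous_on_eq_continuous_within
proof
  fix z :: complex assume z: "z \<in> sphere 0 1"
  show "continuous (at z within sphere 0 1) (\<lambda>z. F (log_height z))"
  proof (cases "z = 1")
    case True
    have h1: "F (log_height 1) = 0" using F1 by (simp add: log_height_def log_def)
    show ?thesis unfolding True continuous_within_eps_delta
    proof (intro allI impI)
      fix \<epsilon> :: real assume e: "\<epsilon> > 0"
      from lim e have "\<forall>\<^sub>F x in at_top. dist (F x) 0 < \<epsilon>" by (rule tendstoD)
      then obtain K where K: "\<And>x. K \<le> x \<Longrightarrow> \<bar>F x\<bar> < \<epsilon>" by (auto simp: eventually_at_top_linorder)
      show "\<exists>d>0. \<forall>x\<in>sphere 0 1. dist x 1 < d \<longrightarrow> dist (F (log_height x)) (F (log_height 1)) < \<epsilon>"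
      \<comment> \<open>For points other than 1, a distance below 2^(2 - K) means a height above
        K.\<close>
      proof (intro exI[of _ "2 powr (2 - K)"] conjI ballI impI)
        fix x :: complex assume x: "x \<in> sphere 0 1" "dist x 1 < 2 powr (2 - K)"
        show "dist (F (log_height x)) (F (log_height 1)) < \<epsilon>"
        proof (cases "x = 1")
          case False
          have "cmod (1 - x) < 2 powr (2 - K)" using x by (simp add: dist_norm norm_minus_commute)
          then have "log 2 (cmod (1 - x)) < log 2 (2 powr (2 - K))"
            using False by (subst log_less_cancel_iff) auto
          then have "K \<le> log_height x" using False by (simp add: log_height_eq)
          then show ?thesis using K h1 by (simp add: dist_real_def)
        qed (use e in simp)
      qed simp
    qed
  next
    case False
    have c: "continuous_on (sphere 0 1 - {1}) (\<lambda>z. F (log_height z))"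
    proof (rule continuous_on_compose2[OF cont])
      show "continuous_on (sphere 0 1 - {1}) log_height"
        unfolding log_height_def by (intro continuous_intros) auto
      show "log_height ` (sphere 0 1 - {1}) \<subseteq> {1..}" using log_height_ge_1 by auto
    qed
    have "at z within sphere 0 1 = at z within (sphere 0 1 - {1})"
      by (rule at_within_nhd[of _ "- {1}"]) (use False in auto)
    then show ?thesis using c z False by (simp add: continuous_on_eq_continuous_within)
  qed
qed

lemma continuous_on_tilt_log_height: "continuous_on (sphere 0 1) (\<lambda>z. tilt (log_height z))"
proof (rule continuous_on_comp_log_height[OF continuous_on_tilt tilt_1])
  show "(tilt \<longlongrightarrow> 0) at_top"
  proof (rule Lim_null_comparison)
    show "\<forall>\<^sub>F x in at_top. norm (tilt x) \<le> x powr (- 1/4)"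
      using eventually_ge_at_top[of 1] by eventually_elim (use tilt_bounds in auto)
    show "((\<lambda>x::real. x powr (- 1/4)) \<longlongrightarrow> 0) at_top" by real_asymp
  qed
qed

lemma continuous_on_ln_tilt_log_height:
  "continuous_on (sphere 0 1) (\<lambda>z. ln (log_height z) * tilt (log_height z))"
proof (rule continuous_on_comp_log_height)
  show "continuous_on {1..} (\<lambda>x. ln x * tilt x)"
    by (intro continuous_intros continuous_on_tilt) auto
  show "((\<lambda>x. ln x * tilt x) \<longlongrightarrow> 0) at_top"
  proof (rule Lim_null_comparison)
    show "\<forall>\<^sub>F x in at_top. norm (ln x * tilt x) \<le> ln x * x powr (- 1/4)"
      using eventually_ge_at_top[of 1]
      by eventually_elim (use tilt_bounds in \<open>auto simp: abs_mult intro!: mult_left_mono\<close>)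
    show "((\<lambda>x::real. ln x * x powr (- 1/4)) \<longlongrightarrow> 0) at_top" by real_asymp
  qed
qed simp

text \<open>Both eigenvalues and their reciprocals are at most the height, so the integrability of
  \<open>log_height\<close> settles that of the weight and of its inverse at once.\<close>

definition weight :: "complex \<Rightarrow> complex^2^2" where
  "weight z = rot_diag (log_height z) (1 / log_height z) (tilt (log_height z))"

lemma tilt_log_height_le: "z \<in> sphere 0 1 \<Longrightarrow> \<bar>tilt (log_height z)\<bar> \<le> 1"
  using tilt_bounds[OF log_height_ge_1] by simp

lemma vanishing_osc_cong:
  assumes "vanishing_osc f" "\<And>z. z \<in> sphere 0 1 \<Longrightarrow> f z = g z"
  shows "vanishing_osc g"
proof -
  have i: "integrable circle_measure f \<longleftrightarrow> integrable circle_measure g"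
    using assms(2) by (intro Bochner_Integration.integrable_cong) auto
  have s: "(LINT z:I|circle_measure. cmod (f z - c)) = (LINT z:I|circle_measure. cmod (g z - c))" for I c
    unfolding set_lebesgue_integral_def
    using assms(2) by (intro Bochner_Integration.integral_cong) auto
  show ?thesis using assms(1) unfolding vanishing_osc_def i s .
qed

lemma weight_log_VMO: "(\<lambda>z. matrix_log (weight z)) \<in> matrix_VMO"
  unfolding matrix_VMO_def mem_Collect_eq
proof (intro allI vanishing_osc_imp_VMO)
  fix i j :: 2
  let ?L = "\<lambda>z. ln (log_height z)" and ?g = "\<lambda>z. tilt (log_height z)"
  have hm [measurable]: "log_height \<in> borel_measurable circle_measure"
    by (rule measurable_circle_measure) measurable
  have tm [measurable]: "(\<lambda>z. tilt (log_height z)) \<in> borel_measurable circle_measure"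
    by (rule measurable_circle_measure) measurable
  \<comment> \<open>The factors are grouped so that the unbounded \<open>?L\<close> occurs only
    alone or in the product \<open>?L z * ?g z\<close>, which is continuous on the whole
    circle.\<close>
  have log: "matrix_log (weight z) $ i $ j = complex_of_real
      (if i = j then if i = 1 then ?L z - 2 * (?L z * ?g z) * ?g z else - (?L z - 2 * (?L z * ?g z) * ?g z)
       else 2 * (?L z * ?g z) * sqrt (1 - (?g z)\<^sup>2))" if z: "z \<in> sphere 0 1" for z
  proof -
    have "ln (1 / log_height z) = - ln (log_height z)" using log_height_ge_1[OF z] by (simp add: ln_div)
    then have "matrix_log (weight z) = rot_diag (?L z) (- ?L z) (?g z)"
      unfolding weight_def rot_diag_log[OF tilt_log_height_le[OF z]] by simp
    moreover have "?L z * (1 - (?g z)\<^sup>2) + - ?L z * (?g z)\<^sup>2 = ?L z - 2 * (?L z * ?g z) * ?g z"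
      "?L z * (?g z)\<^sup>2 + - ?L z * (1 - (?g z)\<^sup>2) = - (?L z - 2 * (?L z * ?g z) * ?g z)"
      "(?L z - - ?L z) * ?g z = 2 * (?L z * ?g z)"
      by (simp_all add: algebra_simps power2_eq_square)
    ultimately show ?thesis
      unfolding rot_diag_entries[OF tilt_log_height_le[OF z]] by (simp only: vec_lambda_beta)
  qed
  have d: "vanishing_osc (\<lambda>z. complex_of_real (?L z) + complex_of_real (- 2 * (?L z * ?g z) * ?g z))"
    by (intro vanishing_osc_add vanishing_osc_ln_log_height continuous_imp_vanishing_osc continuous_on_of_real
        continuous_on_mult continuous_on_const continuous_on_ln_tilt_log_height continuous_on_tilt_log_height)
      measurable
  have o: "vanishing_osc (\<lambda>z. complex_of_real (2 * (?L z * ?g z) * sqrt (1 - (?g z)\<^sup>2)))"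
    by (intro continuous_imp_vanishing_osc continuous_on_of_real
        continuous_on_mult continuous_on_const continuous_on_ln_tilt_log_height continuous_on_real_sqrt
        continuous_on_diff continuous_on_power continuous_on_tilt_log_height) measurable
  consider "i = j" "i = 1" | "i = j" "i \<noteq> 1" | "i \<noteq> j" by blast
  then show "vanishing_osc (\<lambda>z. matrix_log (weight z) $ i $ j)"
  proof cases
    case 1
    show ?thesis by (rule vanishing_osc_cong[OF d], subst log) (use 1 in auto)
  next
    case 2
    show ?thesis by (rule vanishing_osc_cong[OF vanishing_osc_uminus[OF d]], subst log) (use 2 in auto)
  next
    case 3
    show ?thesis by (rule vanishing_osc_cong[OF o], subst log) (use 3 in auto)
  qed
qed

text \<open>Diagonal entries are convex combinations of a and b, and off-diagonal ones are a - b
  times a factor of modulus at most 1, so 2 * \<open>log_height\<close> dominates them all.\<close>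

lemma integrable_rot_diag:
  assumes [measurable]: "a \<in> borel_measurable circle_measure" "b \<in> borel_measurable circle_measure"
      "g \<in> borel_measurable circle_measure"
    and a: "\<And>z. z \<in> sphere 0 1 \<Longrightarrow> \<bar>a z\<bar> \<le> log_height z"
    and b: "\<And>z. z \<in> sphere 0 1 \<Longrightarrow> \<bar>b z\<bar> \<le> log_height z"
    and g: "\<And>z. z \<in> sphere 0 1 \<Longrightarrow> \<bar>g z\<bar> \<le> 1"
  shows "integrable circle_measure (\<lambda>z. rot_diag (a z) (b z) (g z))"
proof -
  let ?e = "\<lambda>i j z. if i = (j::2) then if i = 1 then a z * (1 - (g z)\<^sup>2) + b z * (g z)\<^sup>2
      else a z * (g z)\<^sup>2 + b z * (1 - (g z)\<^sup>2) else (a z - b z) * g z * sqrt (1 - (g z)\<^sup>2)"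
  have "integrable circle_measure (?e i j)" for i j
  proof (rule Bochner_Integration.integrable_bound)
    show "integrable circle_measure (\<lambda>z. 2 * log_height z)" using log_height_integrable by simp
    show "?e i j \<in> borel_measurable circle_measure" by measurable
    show "AE z in circle_measure. norm (?e i j z) \<le> norm (2 * log_height z)"
    proof (rule AE_I2)
      fix z assume "z \<in> space circle_measure"
      then have z: "z \<in> sphere 0 1" by simp
      define p where "p = (g z)\<^sup>2"
      have p: "0 \<le> p" "p \<le> 1" using g[OF z] by (auto simp: p_def abs_square_le_1)
      have q: "\<bar>s * t\<bar> \<le> log_height z" if "\<bar>s\<bar> \<le> log_height z" "0 \<le> t" "t \<le> 1" for s t
        using mult_mono[OF that(1) that(3)] that log_height_ge_1[OF z] by (simp add: abs_mult)
      have r: "\<bar>g z * sqrt (1 - p)\<bar> \<le> 1"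
        using mult_mono[OF g[OF z], of "sqrt (1 - p)" 1] p by (simp add: abs_mult)
      have "\<bar>(a z - b z) * (g z * sqrt (1 - p))\<bar> \<le> (2 * log_height z) * 1"
        unfolding abs_mult[of "a z - b z"] using r a[OF z] b[OF z] by (intro mult_mono) auto
      then have "norm ((a z - b z) * g z * sqrt (1 - p)) \<le> norm (2 * log_height z)"
        using log_height_ge_1[OF z] by (simp add: mult.assoc)
      moreover have "norm (a z * (1 - p) + b z * p) \<le> norm (2 * log_height z)"
        using q[OF a[OF z], of "1 - p"] q[OF b[OF z], of p] p by simp
      moreover have "norm (a z * p + b z * (1 - p)) \<le> norm (2 * log_height z)"
        using q[OF a[OF z], of p] q[OF b[OF z], of "1 - p"] p by simp
      ultimately show "norm (?e i j z) \<le> norm (2 * log_height z)" by (simp add: p_def)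
    qed
  qed
  then have "integrable circle_measure (\<lambda>z. \<chi> i j. complex_of_real (?e i j z))"
    by (intro integrable_chi integrable_of_real)
  then show ?thesis
    by (rule Bochner_Integration.integrable_cong[THEN iffD1, rotated -1]) (use g in \<open>auto simp: rot_diag_entries\<close>)
qed

lemma log_height_measurable_circle [measurable]: "log_height \<in> borel_measurable circle_measure"
  by (rule measurable_circle_measure) measurable

lemma inverse_log_height_le: "z \<in> sphere 0 1 \<Longrightarrow> \<bar>1 / log_height z\<bar> \<le> log_height z"
  using log_height_ge_1[of z] by (simp add: divide_le_eq mult_ge1_I order_trans[of 1 "log_height z"])

lemma integrable_weight: "integrable circle_measure weight"
  unfolding weight_def using log_height_ge_1
  by (intro integrable_rot_diag tilt_log_height_le inverse_log_height_le) (measurable, force)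

lemma integrable_weight_inv: "integrable circle_measure (\<lambda>z. matrix_inv (weight z))"
proof -
  have "integrable circle_measure (\<lambda>z. rot_diag (1 / log_height z) (log_height z) (tilt (log_height z)))"
    using log_height_ge_1 by (intro integrable_rot_diag tilt_log_height_le inverse_log_height_le) (measurable, force)
  then show ?thesis
  proof (rule Bochner_Integration.integrable_cong[THEN iffD1, rotated -1])
    fix z assume "z \<in> space circle_measure"
    then have z: "z \<in> sphere 0 1" by simp
    show "rot_diag (1 / log_height z) (log_height z) (tilt (log_height z)) = matrix_inv (weight z)"
      using log_height_ge_1[OF z] unfolding weight_def by (subst rot_diag_inv[OF tilt_log_height_le[OF z]]) auto
  qed simp
qed

lemma matrix_weight_weight: "matrix_weight weight"
  unfolding matrix_weight_def
proof (intro conjI ballI integrable_weight AE_I2)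
  have pos: "0 < (if i = 1 then log_height z else 1 / log_height z)" if "z \<in> sphere 0 1" for i :: 2 and z
    using log_height_ge_1[OF that] by auto
  fix z
  show "nonneg_matrix (weight z)" if "z \<in> sphere 0 1"
    unfolding weight_def rot_diag_def using pos[OF that] by (intro nonneg_spectral) (simp add: less_imp_le)
  show "posdef_matrix (weight z)" if "z \<in> space circle_measure"
    unfolding weight_def rot_diag_def using that
    by (intro posdef_spectral unitary_rot tilt_log_height_le pos) auto
qed

lemma exists_weight_process:
  "\<exists>(M :: real measure) (x :: int \<Rightarrow> real \<Rightarrow> complex^2).
    stationary_process M x \<and> has_spectral_density M x weight"
proof (rule exists_process_with_density)
  define d where "d = (\<lambda>z (k::2). sqrt (if k = 1 then log_height z else 1 / log_height z))"
  \<comment> \<open>The eigenvectors scaled by the square roots of the eigenvalues: an explicit,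
    measurable factor of the weight.\<close>
  define V where "V = (\<lambda>z. rot (tilt (log_height z)) ** real_diag (d z))"
  have V: "V z $ i $ k = rot (tilt (log_height z)) $ i $ k * complex_of_real (d z k)" for z i k
    by (simp add: V_def matrix_matrix_mult_def real_diag_def if_distrib[of "\<lambda>y. _ * y"] cong: if_cong)
  have tm [measurable]: "(\<lambda>z. tilt (log_height z)) \<in> borel_measurable circle_measure"
    by (rule measurable_circle_measure) measurable
  show m: "(\<lambda>z. V z $ i $ k) \<in> borel_measurable circle_measure" for i k
    unfolding V rot_def vec_lambda_beta d_def by measurable
  show "integrable circle_measure (\<lambda>z. (cmod (V z $ i $ k))\<^sup>2)" for i k
  proof (rule Bochner_Integration.integrable_bound[OF log_height_integrable])
    show "(\<lambda>z. (cmod (V z $ i $ k))\<^sup>2) \<in> borel_measurable circle_measure" using m by measurable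
    show "AE z in circle_measure. norm ((cmod (V z $ i $ k))\<^sup>2) \<le> norm (log_height z)"
    proof (rule AE_I2)
      fix z assume "z \<in> space circle_measure"
      then have z: "z \<in> sphere 0 1" by simp
      have t: "\<bar>tilt (log_height z)\<bar> \<le> 1" by (rule tilt_log_height_le[OF z])
      then have t2: "(tilt (log_height z))\<^sup>2 \<le> 1" by (simp add: abs_square_le_1)
      have "cmod (rot (tilt (log_height z)) $ i $ k) \<le> 1"
        using t t2 by (auto simp: rot_def norm_of_real simp del: of_real_minus)
      then have r: "(cmod (rot (tilt (log_height z)) $ i $ k))\<^sup>2 \<le> 1" by (simp add: power_le_one)
      have "(d z k)\<^sup>2 \<le> log_height z"
        using log_height_ge_1[OF z] inverse_log_height_le[OF z] by (simp add: d_def)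
      then have "(cmod (rot (tilt (log_height z)) $ i $ k))\<^sup>2 * (d z k)\<^sup>2 \<le> 1 * log_height z"
        using r by (intro mult_mono) auto
      then show "norm ((cmod (V z $ i $ k))\<^sup>2) \<le> norm (log_height z)"
        using log_height_ge_1[OF z] by (simp add: V norm_mult power_mult_distrib)
    qed
  qed
  fix z :: complex assume z: "z \<in> sphere 0 1"
  have "real_diag (d z) ** real_diag (d z) = real_diag (\<lambda>i::2. if i = 1 then log_height z else 1 / log_height z)"
    using log_height_ge_1[OF z]
    by (simp add: d_def real_diag_def matrix_matrix_mult_def vec_eq_iff forall_2 sum_2 flip: of_real_mult)
  then show "weight z = V z ** adjoint_matrix (V z)"
    unfolding weight_def rot_diag_def V_def adjoint_matrix_mult adjoint_real_diag
    by (metis matrix_mul_assoc)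
qed

section \<open>Failure of complete regularity\<close>

definition weight22 :: "complex \<Rightarrow> real" where
  "weight22 z = log_height z * (tilt (log_height z))\<^sup>2 + (1 - (tilt (log_height z))\<^sup>2) / log_height z"

lemma weight22_eq:
  assumes "z \<in> sphere 0 1"
  shows "weight z $ 2 $ 2 = complex_of_real (weight22 z)"
  unfolding weight_def rot_diag_entries[OF tilt_log_height_le[OF assms]]
  by (simp add: weight22_def)

lemma weight22_nonneg: "z \<in> sphere 0 1 \<Longrightarrow> 0 \<le> weight22 z"
  and weight22_le: "z \<in> sphere 0 1 \<Longrightarrow> weight22 z \<le> log_height z"
proof -
  assume z: "z \<in> sphere 0 1"
  note h = log_height_ge_1[OF z]
  have t: "(tilt (log_height z))\<^sup>2 \<le> 1" using tilt_log_height_le[OF z] by (simp add: abs_square_le_1)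
  then show "0 \<le> weight22 z" using h by (simp add: weight22_def)
  have "(1 - (tilt (log_height z))\<^sup>2) * (1 / log_height z) \<le> (1 - (tilt (log_height z))\<^sup>2) * log_height z"
    using t inverse_log_height_le[OF z] h by (intro mult_left_mono) auto
  then show "weight22 z \<le> log_height z" by (simp add: weight22_def algebra_simps diff_divide_distrib)
qed

lemma weight22_measurable [measurable]: "weight22 \<in> borel_measurable borel"
  unfolding weight22_def by measurable

lemma integrable_weight22: "integrable circle_measure weight22"
proof (rule Bochner_Integration.integrable_bound[OF log_height_integrable])
  show "weight22 \<in> borel_measurable circle_measure" by (rule measurable_circle_measure) measurable
  show "AE z in circle_measure. norm (weight22 z) \<le> norm (log_height z)"
  proof (rule AE_I2)
    fix z assume "z \<in> space circle_measure"
    then have z: "z \<in> sphere 0 1" by simp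
    show "norm (weight22 z) \<le> norm (log_height z)"
      using weight22_nonneg[OF z] weight22_le[OF z] by simp
  qed
qed

lemma weight22_le_1:
  assumes "z \<in> sphere 0 1" "bump (log_height z) = 0"
  shows "weight22 z \<le> 1"
  using log_height_ge_1[OF assms(1)] by (simp add: weight22_def tilt_def assms(2))

text \<open>The first summand of \<open>weight22\<close> is sqrt x times the square of
  \<open>bump\<close>, and (1/2)^2 gives the factor 1/4; the second summand is nonnegative.\<close>

lemma weight22_ge:
  assumes z: "z \<in> sphere 0 1" and b: "1/2 \<le> bump (log_height z)"
  shows "sqrt (log_height z) / 4 \<le> weight22 z"
proof -
  define x where "x = log_height z"
  have x: "1 \<le> x" using log_height_ge_1[OF z] by (simp add: x_def)
  have t: "(tilt x)\<^sup>2 \<le> 1" using tilt_log_height_le[OF z] by (simp add: x_def abs_square_le_1)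
  have xx: "x * (x powr (- 1/4))\<^sup>2 = sqrt x"
  proof -
    have "(x powr (- 1/4))\<^sup>2 = x powr (- 1/2)" using x by (simp add: power2_eq_square flip: powr_add)
    moreover have "x powr 1 * x powr (- 1/2) = x powr (1 + - 1/2)" by (rule powr_add[symmetric])
    ultimately show ?thesis using x by (simp add: powr_half_sqrt)
  qed
  have "(1/2)\<^sup>2 \<le> (bump x)\<^sup>2" using b by (intro power_mono) (auto simp: x_def)
  then have "sqrt x * (1/4) \<le> sqrt x * (bump x)\<^sup>2" using x by (intro mult_left_mono) (auto simp: power2_eq_square)
  also have "\<dots> = x * (tilt x)\<^sup>2" by (simp add: tilt_def power_mult_distrib flip: xx)
  also have "\<dots> \<le> weight22 z" using t x by (simp add: weight22_def x_def)
  finally show ?thesis by (simp add: x_def)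
qed

lemma log_height_between:
  assumes z: "z \<noteq> 1" and "(1/2) ^ m \<le> cmod (1 - z)"
  shows "log_height z \<le> real m + 2"
proof -
  have "log 2 ((1/2) ^ m) \<le> log 2 (cmod (1 - z))" using z assms by (subst log_le_cancel_iff) auto
  moreover have "log 2 ((1/2) ^ m) = - real m" by (simp add: log_nat_power log_divide)
  ultimately show ?thesis by (simp add: log_height_eq[OF z])
qed

lemma log_height_ge:
  assumes z: "z \<noteq> 1" and "cmod (1 - z) \<le> (1/2) ^ m"
  shows "real m + 2 \<le> log_height z"
proof -
  have "log 2 (cmod (1 - z)) \<le> log 2 ((1/2) ^ m)" using z assms by (subst log_le_cancel_iff) auto
  moreover have "log 2 ((1/2) ^ m) = - real m" by (simp add: log_nat_power log_divide)
  ultimately show ?thesis by (simp add: log_height_eq[OF z])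
qed

section \<open>Geometric sums on the circle\<close>

lemma geometric_norm_le: "(z :: complex) \<in> sphere 0 1 \<Longrightarrow> cmod (\<Sum>k<N. z ^ k) \<le> real N"
  by (rule order_trans[OF norm_sum]) (simp add: norm_power)

text \<open>Telescoping gives (1 - z) P = 1 - z^N. This is the decay of the kernel away from 1, in
  product form so that z = 1 needs no exception.\<close>

lemma geometric_norm_le_divide:
  fixes z :: complex
  assumes "z \<in> sphere 0 1" 
  shows "cmod (1 - z) * cmod (\<Sum>k<N. z ^ k) \<le> 2"
proof -
  have "(1 - z) * (\<Sum>k<N. z ^ k) = 1 - z ^ N"
    by (metis one_diff_power_eq)
  then have "cmod (1 - z) * cmod (\<Sum>k<N. z ^ k) = cmod (1 - z ^ N)" by (metis norm_mult)
  also have "\<dots> \<le> 2" using norm_triangle_ineq4[of 1 "z ^ N"] assms by (simp add: norm_power)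
  finally show ?thesis .
qed

lemma norm_power_diff_1_le:
  fixes z :: complex
  assumes "z \<in> sphere 0 1"
  shows "cmod (z ^ m - 1) \<le> real m * cmod (1 - z)"
proof -
  have "cmod (1 - z) * cmod (\<Sum>k<m. z ^ k) = cmod (1 - z ^ m)"
    by (metis one_diff_power_eq norm_mult)
  moreover have "cmod (1 - z) * cmod (\<Sum>k<m. z ^ k) \<le> cmod (1 - z) * real m"
    using geometric_norm_le[OF assms] by (intro mult_left_mono) auto
  ultimately show ?thesis by (simp add: norm_minus_commute mult.commute)
qed

lemma power_times_geometric_sq:
  fixes z :: complex
  shows "z ^ m * (\<Sum>k<N. z ^ k)\<^sup>2 = (\<Sum>k<N. \<Sum>l<N. z ^ (m + k + l))"
proof -
  have "z ^ m * (\<Sum>k<N. z ^ k)\<^sup>2 = (\<Sum>k<N. \<Sum>l<N. z ^ m * (z ^ k * z ^ l))"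
    unfolding power2_eq_square sum_product by (simp only: sum_distrib_left)
  also have "\<dots> = (\<Sum>k<N. \<Sum>l<N. z ^ (m + k + l))"
    by (intro sum.cong refl) (simp add: power_add)
  finally show ?thesis .
qed

text \<open>Expanding the square gives N^2 powers of z with exponents at most m + 2 N, each within
  (m + 2 N) |1 - z| of 1.\<close>

lemma geometric_near_1:
  fixes z :: complex
  assumes z: "z \<in> sphere 0 1"
  shows "cmod (z ^ m * (\<Sum>k<N. z ^ k)\<^sup>2 - (real N)\<^sup>2) \<le> (real N)\<^sup>2 * (real (m + 2 * N) * cmod (1 - z))"
proof -
  have "z ^ m * (\<Sum>k<N. z ^ k)\<^sup>2 - (real N)\<^sup>2 = (\<Sum>k<N. \<Sum>l<N. z ^ (m + k + l) - 1)"
    unfolding power_times_geometric_sq by (simp add: sum_subtractf power2_eq_square)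
  also have "cmod \<dots> \<le> (\<Sum>k<N. \<Sum>l<N. cmod (z ^ (m + k + l) - 1))"
    by (intro order_trans[OF norm_sum] sum_mono norm_sum)
  also have "\<dots> \<le> (\<Sum>k<N. \<Sum>l<N. real (m + 2 * N) * cmod (1 - z))"
  proof (intro sum_mono)
    fix k l assume "k \<in> {..<N}" "l \<in> {..<N}"
    then have "real (m + k + l) * cmod (1 - z) \<le> real (m + 2 * N) * cmod (1 - z)"
      by (intro mult_right_mono) auto
    then show "cmod (z ^ (m + k + l) - 1) \<le> real (m + 2 * N) * cmod (1 - z)"
      using norm_power_diff_1_le[OF z] order_trans by blast
  qed
  also have "\<dots> = (real N)\<^sup>2 * (real (m + 2 * N) * cmod (1 - z))" by (simp add: power2_eq_square)
  finally show ?thesis .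
qed

text \<open>Parseval: the sum consists of N orthonormal functions.\<close>

lemma integral_geometric_sq:
  "integrable circle_measure (\<lambda>z. (cmod (\<Sum>k<N. z ^ k))\<^sup>2)"
  "(LINT z|circle_measure. (cmod (\<Sum>k<N. z ^ k))\<^sup>2) = real N"
proof -
  have m: "(\<lambda>z. z ^ k * cnj (z ^ l)) \<in> borel_measurable circle_measure" for k l
    by (rule measurable_circle_measure) measurable
  have i: "integrable circle_measure (\<lambda>z. z ^ k * cnj (z ^ l))" for k l
    by (rule circle.integrable_const_bound[of _ 1]) (auto simp: m norm_mult norm_power simp del: complex_cnj_power)
  have e: "complex_of_real ((cmod (\<Sum>k<N. z ^ k))\<^sup>2) = (\<Sum>k<N. \<Sum>l<N. z ^ k * cnj (z ^ l))" for z
    by (simp only: complex_norm_square cnj_sum sum_product)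
  have "integrable circle_measure (\<lambda>z. complex_of_real ((cmod (\<Sum>k<N. z ^ k))\<^sup>2))"
    unfolding e by (intro Bochner_Integration.integrable_sum i)
  then have "integrable circle_measure (\<lambda>z. Re (complex_of_real ((cmod (\<Sum>k<N. z ^ k))\<^sup>2)))"
    by (rule integrable_Re)
  then show "integrable circle_measure (\<lambda>z. (cmod (\<Sum>k<N. z ^ k))\<^sup>2)"
    by (simp only: Re_complex_of_real)
  have "complex_of_real (LINT z|circle_measure. (cmod (\<Sum>k<N. z ^ k))\<^sup>2)
      = (LINT z|circle_measure. (\<Sum>k<N. \<Sum>l<N. z ^ k * cnj (z ^ l)))"
    unfolding integral_complex_of_real[symmetric] e ..
  also have "\<dots> = (\<Sum>k<N. \<Sum>l<N. LINT z|circle_measure. z ^ k * cnj (z ^ l))"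
    by (subst Bochner_Integration.integral_sum, intro Bochner_Integration.integrable_sum i,
        subst Bochner_Integration.integral_sum, rule i, rule refl)
  also have "\<dots> = (\<Sum>k<N. \<Sum>l<N. if k = l then 1 else 0)"
    unfolding integral_circle_power_cnj ..
  also have "\<dots> = complex_of_real (real N)" by simp
  finally show "(LINT z|circle_measure. (cmod (\<Sum>k<N. z ^ k))\<^sup>2) = real N"
    by (simp only: of_real_eq_iff)
qed

text \<open>Here d and c are consecutive peaks 4^(k-1) and 4^k, and N is tuned to c. On E the factor
  z^(n+1) P^2 is close to N^2, so both integrals are compared with N^2 * A, and R bounds what comes
  from off E. As A is at least of order r * sqrt c and N is of order 1 / r, the main term exceeds N
  by a factor of order sqrt c, whereas R is at most 2 N.\<close>

lemma weight22_test:
  "\<exists>N T. 0 < T \<and> (LINT z|circle_measure. weight22 z * (cmod (\<Sum>k<N. z ^ k))\<^sup>2) \<le> T \<and>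
    T / 2 \<le> cmod (LINT z|circle_measure. complex_of_real (weight22 z) * (z ^ (n+1) * (\<Sum>k<N. z ^ k)\<^sup>2))"
proof -
  define K where "K = (LINT z|circle_measure. weight22 z)"
  \<comment> \<open>The summand n makes N exceed the gap, the one with K makes 4^d dominate 2^17 *
    K, and 42 is a generous constant that gives sqrt (c - 2) \<ge> 2^20.\<close>
  define k where "k = 42 + n + nat \<lceil>K\<rceil>"
  define d :: nat where "d = 4 ^ (k - 1)"
  define c where "c = 4 * d"
  \<comment> \<open>Then N * r = 2^(-11), small enough that the exponents, at most 3 N, keep the
    relative error on E at 3 * 64 / 2^11 = 3/32.\<close>
  define N :: nat where "N = 2 ^ (c - 11)"
  define r :: real where "r = (1/2) ^ c"
  define q where "q = (\<lambda>z. (cmod (\<Sum>k<N. z ^ k))\<^sup>2)"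
  \<comment> \<open>Outside radius 64 r = 2^(6 - c) the height is at most c - 4, which is where the
    tent around c ends.\<close>
  define E where "E = {z\<in>sphere 0 1. cmod (1 - z) \<le> 64 * r}"
  define A where "A = (LINT z:E|circle_measure. weight22 z)"
  define R where "R = real N + 4 ^ (d + 3) * K"
  have k42: "42 \<le> k" "n \<le> k" by (auto simp: k_def)
  have c4: "c = 4 ^ k" unfolding c_def d_def using k42 by (metis Suc_diff_1 less_le_trans power_Suc zero_less_numeral)
  have kd: "k \<le> d"
    unfolding d_def using k42 power_gt_expt[of 4 "k-1"] by simp
  have Kd: "2 ^ 17 * K \<le> 4 ^ d"
  proof -
    have "real (k - 42) \<ge> K" by (simp add: k_def) linarith
    moreover have "real (k - 42) \<le> 2 ^ (k - 42)" by (rule less_imp_le[OF of_nat_less_two_power])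
    ultimately have "K \<le> 2 ^ (k - 42)" by (rule order_trans)
    then have "2 ^ 17 * K \<le> 2 ^ 17 * 2 ^ (k - 42)" by simp
    also have "\<dots> = (2::real) ^ (17 + (k - 42))" by (simp only: power_add)
    also have "\<dots> \<le> 2 ^ (2 * d)" using kd k42 by (intro power_increasing) auto
    finally show ?thesis by (simp add: power_mult)
  qed
  have c42: "4 ^ 42 \<le> c" unfolding c4 using k42 by (intro power_increasing) auto
  have c11: "11 \<le> c" using c42 by simp
  have Nc: "real N * 2 ^ 11 = 2 ^ c"
  proof -
    have "real N * 2 ^ 11 = 2 ^ (c - 11 + 11)" unfolding power_add N_def by simp
    then show ?thesis using c11 by simp
  qed
  have Nr: "real N * r = 1 / 2 ^ 11" using Nc by (simp add: r_def power_one_over field_simps)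
  have N: "n + 1 \<le> N"
  proof -
    have "n + 1 \<le> c - 11" using k42 kd by (simp add: c_def)
    also have "\<dots> < 2 ^ (c - 11)" by (rule less_exp)
    finally show ?thesis by (simp add: N_def)
  qed
  have r: "0 < r" "16 * r \<le> 1" "r \<le> 1"
  proof -
    show "0 < r" by (simp add: r_def)
    have "r \<le> (1/2) ^ 4" unfolding r_def using c11 by (intro power_decreasing) auto
    then show "16 * r \<le> 1" "r \<le> 1" by (simp_all add: power_def)
  qed
  have wi: "integrable circle_measure weight22" by (rule integrable_weight22)
  have Es: "E \<in> sets circle_measure"
    unfolding E_def by (rule sets_circle_measure_Collect) measurable
  have wE: "set_integrable circle_measure E weight22" using wi Es by (rule set_integrable_circle)
  have K0: "0 \<le> K" unfolding K_def using weight22_nonneg by (intro Bochner_Integration.integral_nonneg) auto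
  have qi: "integrable circle_measure q" and q: "(LINT z|circle_measure. q z) = real N"
    unfolding q_def by (rule integral_geometric_sq)+
  have qN: "q z \<le> (real N)\<^sup>2" if "z \<in> sphere 0 1" for z
    unfolding q_def using geometric_norm_le[OF that] by (intro power_mono) auto
  \<comment> \<open>Off E either w \<le> 1 (between the two peaks) or q \<le> 4^(d+3) (farther
    away); the sum of the two bounds covers both cases, and R is its integral.\<close>
  have outside: "weight22 z * q z \<le> q z + 4 ^ (d + 3) * weight22 z" if z: "z \<in> sphere 0 1" "z \<notin> E" for z
  proof -
    have s: "64 * r < cmod (1 - z)" using z by (simp add: E_def)
    then have z1: "z \<noteq> 1" using r by auto
    have w0: "0 \<le> weight22 z" using weight22_nonneg z by blast
    have q0: "0 \<le> q z" by (simp add: q_def)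
    show ?thesis
    \<comment> \<open>Closer than this the height is at least d + 4, past the tent around d; farther
      away the kernel bound gives |P| \<le> 2^(d+3).\<close>
    proof (cases "(1/2) ^ (d + 2) \<le> cmod (1 - z)")
      case True
      have "(1/2) ^ (d + 2) * cmod (\<Sum>k<N. z ^ k) \<le> cmod (1 - z) * cmod (\<Sum>k<N. z ^ k)"
        using True by (intro mult_right_mono) auto
      also have "\<dots> \<le> 2" by (rule geometric_norm_le_divide[OF z(1)])
      finally have "cmod (\<Sum>k<N. z ^ k) \<le> 2 ^ (d + 3)" by (simp add: power_one_over field_simps power_add)
      then have "q z \<le> (2 ^ (d + 3))\<^sup>2" unfolding q_def by (intro power_mono) auto
      also have "\<dots> = 4 ^ (d + 3)" by (simp add: power2_eq_square flip: power_mult_distrib)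
      finally have "weight22 z * q z \<le> weight22 z * 4 ^ (d + 3)" using w0 by (intro mult_left_mono)
      then show ?thesis using q0 by (simp add: mult.commute)
    next
      case False
      have "real (d + 2) + 2 \<le> log_height z" using False by (intro log_height_ge z1) simp
      moreover have "log_height z \<le> real (c - 6) + 2"
      proof (rule log_height_between[OF z1])
        have "(1/2::real) ^ (c - 6) * (1/2) ^ 6 = r" using c11 by (simp add: r_def flip: power_add)
        then have "(1/2::real) ^ (c - 6) = 64 * r" by (simp add: power_one_over)
        then show "(1/2) ^ (c - 6) \<le> cmod (1 - z)" using s by simp
      qed
      ultimately have x: "real d + 4 \<le> log_height z" "log_height z \<le> real c - 4" using c11 by auto
      have "bump (log_height z) = 0"
      proof (rule bump_eq_0)
        fix j :: nat
        show "4 \<le> \<bar>log_height z - 4 ^ j\<bar>"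
        proof (cases "j < k")
          case True
          then have "(4::real) ^ j \<le> 4 ^ (k - 1)" by (intro power_increasing) auto
          then have "4 ^ j \<le> real d" by (simp add: d_def)
          then show ?thesis using x by linarith
        next
          case False
          then have "(4::real) ^ k \<le> 4 ^ j" by (intro power_increasing) auto
          then have "real c \<le> 4 ^ j" by (simp add: c4)
          then show ?thesis using x by linarith
        qed
      qed
      then have "weight22 z \<le> 1" using weight22_le_1 z by blast
      then have "weight22 z * q z \<le> 1 * q z" using q0 by (intro mult_right_mono)
      moreover have "0 \<le> 4 ^ (d + 3) * weight22 z" using w0 by simp
      ultimately show ?thesis by linarith
    qed
  qed
  \<comment> \<open>On the annulus from r to 16 r, of measure at least r / 8, the height lies in
    [c - 2, c + 2], so \<open>bump\<close> is at least 1/2 and w at least sqrt (c - 2) / 4.\<close>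
  have A_ge: "sqrt (real c - 2) * r / 32 \<le> A"
  proof -
    define E' where "E' = {z\<in>sphere 0 1. r \<le> cmod (1 - z) \<and> cmod (1 - z) \<le> 16 * r}"
    have E's: "E' \<in> sets circle_measure"
      unfolding E'_def by (rule sets_circle_measure_Collect) measurable
    have "E' \<subseteq> E" using r by (auto simp: E_def E'_def)
    have "sqrt (real c - 2) / 4 * (r / 8) \<le> sqrt (real c - 2) / 4 * measure circle_measure E'"
      unfolding E'_def using r c11 by (intro mult_left_mono measure_circle_annulus) auto
    also have "\<dots> = (LINT z:E'|circle_measure. sqrt (real c - 2) / 4)"
      using E's by (simp add: set_integral_const_circle)
    also have "\<dots> \<le> (LINT z:E'|circle_measure. weight22 z)"
    proof (rule set_integral_mono)
      show "set_integrable circle_measure E' (\<lambda>z. sqrt (real c - 2) / 4)"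
        using E's by (intro set_integrable_circle) auto
      show "set_integrable circle_measure E' weight22" using wi E's by (rule set_integrable_circle)
      fix z assume z: "z \<in> E'"
      then have zs: "z \<in> sphere 0 1" and s: "r \<le> cmod (1 - z)" "cmod (1 - z) \<le> 16 * r"
        by (auto simp: E'_def)
      have z1: "z \<noteq> 1" using s r by auto
      have "log_height z \<le> real c + 2" using s by (intro log_height_between z1) (simp add: r_def)
      moreover have "real (c - 4) + 2 \<le> log_height z"
      proof (rule log_height_ge[OF z1])
        have "(1/2::real) ^ (c - 4) * (1/2) ^ 4 = r" using c11 by (simp add: r_def flip: power_add)
        then have "(1/2::real) ^ (c - 4) = 16 * r" by (simp add: power_one_over)
        then show "cmod (1 - z) \<le> (1/2) ^ (c - 4)" using s by simp
      qed
      ultimately have x: "\<bar>log_height z - 4 ^ k\<bar> \<le> 2" "real c - 2 \<le> log_height z"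
        using c11 c4 by (auto simp: abs_le_iff)
      have "sqrt (real c - 2) / 4 \<le> sqrt (log_height z) / 4" using x by simp
      also have "\<dots> \<le> weight22 z"
        using k42 by (intro weight22_ge zs bump_ge_half[OF _ x(1)]) simp
      finally show "sqrt (real c - 2) / 4 \<le> weight22 z" .
    qed
    also have "\<dots> \<le> A"
      unfolding A_def set_lebesgue_integral_def
    proof (rule Bochner_Integration.integral_mono)
      fix z assume "z \<in> space circle_measure"
      then show "indicat_real E' z *\<^sub>R weight22 z \<le> indicat_real E z *\<^sub>R weight22 z"
        using \<open>E' \<subseteq> E\<close> weight22_nonneg[of z] by (auto simp: indicator_def)
    qed (rule integrable_mult_indicator[OF E's wi] integrable_mult_indicator[OF Es wi])+
    finally show ?thesis by simp
  qed
  have sq: "2 ^ 20 \<le> sqrt (real c - 2)"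
  proof (rule real_le_rsqrt)
    have "(4::real) ^ 42 \<le> real c" using c42 by (metis of_nat_le_iff of_nat_numeral of_nat_power)
    then show "(2 ^ 20)\<^sup>2 \<le> real c - 2" by simp
  qed
  have R_le: "R \<le> (real N)\<^sup>2 * A / 4"
  proof -
    have "2 ^ 20 * r / 32 \<le> A"
      using A_ge sq r by (meson order_trans mult_right_mono divide_right_mono less_imp_le zero_le_numeral)
    then have "(real N)\<^sup>2 * (2 ^ 20 * r / 32) \<le> (real N)\<^sup>2 * A" by (intro mult_left_mono) auto
    moreover have "(real N)\<^sup>2 * (2 ^ 20 * r / 32) = real N * (real N * r) * 2 ^ 15"
      by (simp add: power2_eq_square)
    moreover have "real N * (real N * r) * 2 ^ 15 = 16 * real N" unfolding Nr by simp
    ultimately have "16 * real N \<le> (real N)\<^sup>2 * A" by linarith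
    \<comment> \<open>This uses the ratio 4 of the peaks: 2^c = 4^d * 4^d, where one factor is the
      kernel in the far region and the other absorbs K and the constants.\<close>
    moreover have "4 ^ (d + 3) * K \<le> real N"
    proof -
      have "2 ^ 11 * (4 ^ (d + 3) * K) = 4 ^ d * (2 ^ 17 * K)" by (simp add: power_add)
      also have "\<dots> \<le> 4 ^ d * 4 ^ d" using Kd by (intro mult_left_mono) auto
      also have "\<dots> = 2 ^ c" by (simp add: c_def power_mult flip: power_mult_distrib)
      also have "\<dots> = 2 ^ 11 * real N" using Nc by simp
      finally show ?thesis by simp
    qed
    ultimately show ?thesis by (simp add: R_def)
  qed
  have qm: "(\<lambda>z. q z) \<in> borel_measurable circle_measure" using qi by auto
  have wm: "weight22 \<in> borel_measurable circle_measure" using wi by auto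
  \<comment> \<open>A single majorant with a free factor C on E: C = N^2 bounds the norms, C = 3/32
    * N^2 bounds the error of the correlation.\<close>
  have Bi: "integrable circle_measure (\<lambda>z. C * (indicator E z *\<^sub>R weight22 z) + (q z + 4 ^ (d + 3) * weight22 z))" for C
    using wi qi wE by (auto simp: set_integrable_def)
  have Bint: "(LINT z|circle_measure. C * (indicator E z *\<^sub>R weight22 z) + (q z + 4 ^ (d + 3) * weight22 z)) = C * A + R" for C
    using wi qi wE by (simp add: set_integrable_def A_def set_lebesgue_integral_def R_def q K_def)
  define T where "T = (real N)\<^sup>2 * A + R"
  have T0: "0 < T"
  proof -
    have "0 < R" unfolding R_def using K0 N by (intro add_pos_nonneg) auto
    then show ?thesis using R_le by (simp add: T_def)
  qed
  have norm1: "(LINT z|circle_measure. weight22 z * q z) \<le> T"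
  proof -
    have pt: "weight22 z * q z \<le> (real N)\<^sup>2 * (indicator E z *\<^sub>R weight22 z) + (q z + 4 ^ (d + 3) * weight22 z)"
      if z: "z \<in> sphere 0 1" for z
    proof (cases "z \<in> E")
      case True
      have "weight22 z * q z \<le> weight22 z * (real N)\<^sup>2"
        using qN[OF z] weight22_nonneg[OF z] by (intro mult_left_mono) auto
      moreover have "0 \<le> q z" by (simp add: q_def)
      ultimately show ?thesis using True weight22_nonneg[OF z] by (simp add: mult.commute add_increasing2)
    next
      case False
      then show ?thesis using outside[OF z] by simp
    qed
    have "(LINT z|circle_measure. weight22 z * q z)
        \<le> (LINT z|circle_measure. (real N)\<^sup>2 * (indicator E z *\<^sub>R weight22 z) + (q z + 4 ^ (d + 3) * weight22 z))"
    proof (rule Bochner_Integration.integral_mono[OF _ Bi])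
      show "integrable circle_measure (\<lambda>z. weight22 z * q z)"
      proof (rule Bochner_Integration.integrable_bound[OF Bi[of "(real N)\<^sup>2"]])
        show "(\<lambda>z. weight22 z * q z) \<in> borel_measurable circle_measure" using wm qm by measurable
        show "AE z in circle_measure. norm (weight22 z * q z)
            \<le> norm ((real N)\<^sup>2 * (indicator E z *\<^sub>R weight22 z) + (q z + 4 ^ (d + 3) * weight22 z))"
        proof (rule AE_I2)
          fix z assume "z \<in> space circle_measure"
          then have z: "z \<in> sphere 0 1" by simp
          have "0 \<le> weight22 z * q z" using weight22_nonneg[OF z] by (simp add: q_def)
          then show "norm (weight22 z * q z)
            \<le> norm ((real N)\<^sup>2 * (indicator E z *\<^sub>R weight22 z) + (q z + 4 ^ (d + 3) * weight22 z))"
            unfolding real_norm_def using pt[OF z] by linarith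
        qed
      qed
    qed (use pt in auto)
    then show ?thesis unfolding Bint T_def .
  qed
  define F where "F = (\<lambda>z. complex_of_real (weight22 z) * (z ^ (n+1) * (\<Sum>k<N. z ^ k)\<^sup>2))"
  \<comment> \<open>The idealized integrand: z^(n+1) P^2 is replaced by N^2 on E and by 0 elsewhere,
    so that its integral is exactly N^2 * A.\<close>
  define G where "G = (\<lambda>z. complex_of_real ((real N)\<^sup>2 * (indicator E z *\<^sub>R weight22 z)))"
  have FG: "cmod (F z - G z) \<le> 3/32 * (real N)\<^sup>2 * (indicator E z *\<^sub>R weight22 z) + (q z + 4 ^ (d + 3) * weight22 z)"
    if z: "z \<in> sphere 0 1" for z
  proof -
    note w0 = weight22_nonneg[OF z]
    have q0: "0 \<le> q z" by (simp add: q_def)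
    show ?thesis
    proof (cases "z \<in> E")
      case True
      have "F z - G z = complex_of_real (weight22 z) * (z ^ (n+1) * (\<Sum>k<N. z ^ k)\<^sup>2 - (real N)\<^sup>2)"
        using True by (simp add: F_def G_def right_diff_distrib)
      then have "cmod (F z - G z) = weight22 z * cmod (z ^ (n+1) * (\<Sum>k<N. z ^ k)\<^sup>2 - (real N)\<^sup>2)"
        using w0 by (simp only: norm_mult norm_of_real abs_of_nonneg)
      also have "\<dots> \<le> weight22 z * ((real N)\<^sup>2 * (3/32))"
      proof (rule mult_left_mono[OF _ w0], rule order_trans[OF geometric_near_1[OF z]], rule mult_left_mono)
        have "real (n + 1 + 2 * N) * cmod (1 - z) \<le> (3 * real N) * (64 * r)"
          using N True by (intro mult_mono) (auto simp: E_def)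
        also have "\<dots> = 192 * (real N * r)" by simp
        also have "\<dots> = 3/32" by (simp add: Nr)
        finally show "real (n + 1 + 2 * N) * cmod (1 - z) \<le> 3/32" .
      qed simp
      finally have "cmod (F z - G z) \<le> 3/32 * (real N)\<^sup>2 * (indicator E z *\<^sub>R weight22 z)"
        using True by (simp add: mult_ac)
      moreover have "0 \<le> q z + 4 ^ (d + 3) * weight22 z" using q0 w0 by simp
      ultimately show ?thesis by linarith
    next
      case False
      have "cmod (F z) = weight22 z * q z"
        using w0 z by (simp add: F_def q_def norm_mult norm_power)
      then show ?thesis using outside[OF z False] False by (simp add: G_def)
    qed
  qed
  have Fm: "F \<in> borel_measurable circle_measure"
  proof -
    have "(\<lambda>z. z ^ (n+1) * (\<Sum>k<N. z ^ k)\<^sup>2) \<in> borel_measurable circle_measure"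
      by (rule measurable_circle_measure) measurable
    then show ?thesis unfolding F_def using wm by measurable
  qed
  have Gi: "integrable circle_measure G"
    using wE unfolding G_def set_integrable_def by (intro integrable_of_real integrable_mult_right)
  have FGi: "integrable circle_measure (\<lambda>z. F z - G z)"
  proof (rule Bochner_Integration.integrable_bound[OF Bi[of "3/32 * (real N)\<^sup>2"]])
    show "(\<lambda>z. F z - G z) \<in> borel_measurable circle_measure" using Fm Gi by measurable
    show "AE z in circle_measure. norm (F z - G z) \<le> norm
        (3/32 * (real N)\<^sup>2 * (indicator E z *\<^sub>R weight22 z) + (q z + 4 ^ (d + 3) * weight22 z))"
      using FG by (intro AE_I2) (force intro: order_trans[OF _ abs_ge_self])
  qed
  have Fi: "integrable circle_measure F"
    using Bochner_Integration.integrable_add[OF FGi Gi] by simp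
  have "cmod (LINT z|circle_measure. F z - G z) \<le> 3/32 * (real N)\<^sup>2 * A + R"
  proof -
    have "cmod (LINT z|circle_measure. F z - G z) \<le> (LINT z|circle_measure. cmod (F z - G z))"
      by (rule integral_norm_bound)
    also have "\<dots> \<le> (LINT z|circle_measure. 3/32 * (real N)\<^sup>2 * (indicator E z *\<^sub>R weight22 z) + (q z + 4 ^ (d + 3) * weight22 z))"
      using FGi FG by (intro Bochner_Integration.integral_mono Bi integrable_norm) auto
    finally show ?thesis unfolding Bint .
  qed
  moreover have "(LINT z|circle_measure. G z) = complex_of_real ((real N)\<^sup>2 * A)"
    unfolding G_def integral_complex_of_real A_def set_lebesgue_integral_def integral_mult_right_zero ..
  moreover have "(LINT z|circle_measure. F z - G z) = (LINT z|circle_measure. F z) - (LINT z|circle_measure. G z)"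
    using Fi Gi by (rule Bochner_Integration.integral_diff)
  ultimately have h1: "cmod ((LINT z|circle_measure. F z) - complex_of_real ((real N)\<^sup>2 * A))
      \<le> 3/32 * ((real N)\<^sup>2 * A) + R"
    by (simp add: mult.assoc)
  have h2: "(real N)\<^sup>2 * A \<le> cmod (complex_of_real ((real N)\<^sup>2 * A))"
    unfolding norm_of_real by (rule abs_ge_self)
  have h3: "cmod (complex_of_real ((real N)\<^sup>2 * A)) \<le> cmod (LINT z|circle_measure. F z)
      + cmod ((LINT z|circle_measure. F z) - complex_of_real ((real N)\<^sup>2 * A))"
    using norm_triangle_sub[of "complex_of_real ((real N)\<^sup>2 * A)" "LINT z|circle_measure. F z"]
    by (simp only: norm_minus_commute)
  \<comment> \<open>Here B stands for N^2 * A. The correlation is at least 29/32 B - R, so it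
    suffices that 3/2 R \<le> 13/32 B, and R \<le> B / 4 gives 12/32 B.\<close>
  have "(B + R) / 2 \<le> f"
    if "g \<le> 3/32 * B + R" "B \<le> b" "b \<le> f + g" "R \<le> B / 4" "0 < B + R" for B b f g :: real
  proof -
    have "0 < B" using that by simp
    moreover have "f \<ge> 29/32 * B - R" using that by simp
    ultimately show ?thesis using that(4) by simp
  qed
  from this[OF h1 h2 h3 R_le] have "T / 2 \<le> cmod (LINT z|circle_measure. F z)"
    using T0 unfolding T_def .
  then show ?thesis
    by (intro exI[of _ N] exI[of _ T] conjI T0 norm1[unfolded q_def] ) (unfold F_def)
qed

lemma weight_not_regular:
  "stationary_process M x \<Longrightarrow> has_spectral_density M x weight \<Longrightarrow> \<not> completely_regular M x"
  by (rule not_completely_regularI[OF _ _ weight22_eq integrable_weight22 weight22_test])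

text \<open>The clause with a process on the reals ensures that the last clause, about all processes
  with this density, is not empty talk: the type \<open>'a\<close> may be too small to carry any
  such process.\<close>

theorem mainTheorem3:
  "\<exists>W :: complex \<Rightarrow> complex^2^2.
     matrix_weight W \<and>
     integrable circle_measure (\<lambda>z. matrix_inv (W z)) \<and>
     (\<lambda>z. matrix_log (W z)) \<in> matrix_VMO \<and>
     (\<exists>(M :: real measure) (x :: int \<Rightarrow> real \<Rightarrow> complex^2).
        stationary_process M x \<and> has_spectral_density M x W \<and> \<not> completely_regular M x) \<and>
     (\<forall>(M :: 'a measure) (x :: int \<Rightarrow> 'a \<Rightarrow> complex^2).
        stationary_process M x \<and> has_spectral_density M x W \<longrightarrow> \<not> completely_regular M x)"
proof (intro exI[of _ weight] conjI allI impI)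
  obtain M :: "real measure" and x :: "int \<Rightarrow> real \<Rightarrow> complex^2"
    where Mx: "stationary_process M x" "has_spectral_density M x weight"
    using exists_weight_process by blast
  show "\<exists>(M :: real measure) (x :: int \<Rightarrow> real \<Rightarrow> complex^2).
      stationary_process M x \<and> has_spectral_density M x weight \<and> \<not> completely_regular M x"
    by (intro exI[of _ M] exI[of _ x] conjI Mx weight_not_regular[OF Mx])
qed (auto intro: matrix_weight_weight integrable_weight_inv weight_log_VMO dest: weight_not_regular)

end
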